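(* Let $A$ be an involutive algebra and let $\Gamma$ be a nonempty subset of $X^*(A)$. Then: (1) There exists at least one $LC^*$-topology on $A$ compatible with the duality between $A$ and $\Gamma$. (2) Every $LC^*$-topology on $A$ compatible with the duality between $A$ and $\Gamma$ is the topology of uniform convergence on some collection of compact subsets of the space $X^*(A)$ that are contained in $\Gamma$ and cover $\Gamma$. (3) Among all $LC^*$-topologies on $A$ compatible with the duality between $A$ and $\Gamma$ there are a weakest and a strongest one. The weakest is the topology of uniform convergence on all finite subsets of $\Gamma$; the strongest is the topology of uniform convergence on all compact subsets of $X^*(A)$ contained in $\Gamma$. (4) An $LC^*$-topology on $A$ compatible with the duality between $A$ and $\Gamma$ is Hausdorff if and only if the elements of $\Gamma$ separate the points of $A$. (5) The minimal continuous $C^*$-seminorms on $A$ are the same for all $LC^*$-topologies on $A$ compatible with the duality between $A$ and $\Gamma$.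
   Context: "Algebra" means commutative associative algebra over $\mathbb{C}$ with unit. An involutive algebra is an algebra with a conjugate-linear map $x\mapsto x^*$ satisfying $(x^* )^*=x$, $(xy)^*=y^*x^*$. A character is a unit-preserving algebra homomorphism to $\mathbb{C}$; it is hermitian if $\chi(x^* )=\overline{\chi(x)}$ for all $x$. $X^*(A)$ is the set of hermitian characters of $A$ with the topology of pointwise convergence on $A$. A $C^*$-seminorm on $A$ is a seminorm $p$ with $p(xx^* )=p(x)^2$ for all $x$. An $LC^*$-topology on $A$ is a topology defined by a family of $C^*$-seminorms (not necessarily Hausdorff). For a topology $t$ on $A$, $X_c^*(A,t)$ denotes the set of $t$-continuous hermitian characters. The topology $t$ is said to be compatible with the duality between $A$ and $\Gamma\subset X^*(A)$ if $X_c^*(A,t)=\Gamma$. The topology of uniform convergence on a collection $\mathcal{B}$ of compact subsets of $X^*(A)$ is the topology generated by the seminorms $p^K(a)=\sup\{|\chi(a)|:\chi\in K\}$, $K\in\mathcal{B}$. A continuous $C^*$-seminorm $p$ is a minimal continuous $C^*$-seminorm if $p\ne0$ and for every nonzero continuous $C^*$-seminorm $q$ on $A$, $q\le p$ implies $q=p$. "Weakest"/"strongest" refer to inclusion of topologies. *)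

theory Defs
  imports "HOL-Analysis.Analysis"
begin

text \<open>The class \<open>comm_ring_1\<close> contains the axiom \<open>0 \<noteq> 1\<close>. This excludes only the zero
  algebra, which has no characters.\<close>

class involutive_algebra = comm_ring_1 +
  fixes scaleC :: "complex \<Rightarrow> 'a \<Rightarrow> 'a"  (infixr \<open>*\<^sub>C\<close> 75)
    and star :: "'a \<Rightarrow> 'a"
  assumes scaleC_add_right: "c *\<^sub>C (x + y) = c *\<^sub>C x + c *\<^sub>C y"
    and scaleC_add_left: "(c + d) *\<^sub>C x = c *\<^sub>C x + d *\<^sub>C x"
    and scaleC_scaleC: "c *\<^sub>C d *\<^sub>C x = (c * d) *\<^sub>C x"
    and scaleC_one: "1 *\<^sub>C x = x"
    and mult_scaleC_left: "(c *\<^sub>C x) * y = c *\<^sub>C (x * y)"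
    and star_add: "star (x + y) = star x + star y"
    and star_scaleC: "star (c *\<^sub>C x) = cnj c *\<^sub>C star x"
    and star_star: "star (star x) = x"
    and star_mult: "star (x * y) = star y * star x"

definition character :: "('a::involutive_algebra \<Rightarrow> complex) \<Rightarrow> bool" where
  "character \<phi> \<longleftrightarrow>
     (\<forall>x y. \<phi> (x + y) = \<phi> x + \<phi> y) \<and>
     (\<forall>c x. \<phi> (c *\<^sub>C x) = c * \<phi> x) \<and>
     (\<forall>x y. \<phi> (x * y) = \<phi> x * \<phi> y) \<and>
     \<phi> 1 = 1"

definition hermitian_characters :: "('a::involutive_algebra \<Rightarrow> complex) set" where
  "hermitian_characters = {\<phi>. character \<phi> \<and> (\<forall>x. \<phi> (star x) = cnj (\<phi> x))}"

definition hermitian_character_space :: "('a::involutive_algebra \<Rightarrow> complex) topology" where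
  "hermitian_character_space =
     subtopology (product_topology (\<lambda>_. euclidean) UNIV) hermitian_characters"

definition seminorm :: "('a::involutive_algebra \<Rightarrow> real) \<Rightarrow> bool" where
  "seminorm p \<longleftrightarrow>
     (\<forall>x. 0 \<le> p x) \<and>
     (\<forall>x y. p (x + y) \<le> p x + p y) \<and>
     (\<forall>c x. p (c *\<^sub>C x) = cmod c * p x)"

text \<open>Submultiplicativity is deliberately not required.\<close>

definition Cstar_seminorm :: "('a::involutive_algebra \<Rightarrow> real) \<Rightarrow> bool" where
  "Cstar_seminorm p \<longleftrightarrow> seminorm p \<and> (\<forall>x. p (x * star x) = (p x)\<^sup>2)"

text \<open>Inserting \<open>UNIV\<close> only matters for \<open>P = {}\<close>, where it yields the indiscrete topology;
  otherwise the generated topology would have empty carrier.\<close>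

definition seminorms_topology :: "('a::involutive_algebra \<Rightarrow> real) set \<Rightarrow> 'a topology" where
  "seminorms_topology P =
     topology_generated_by (insert UNIV {{y. p (y - x) < e} | p x e. p \<in> P \<and> 0 < e})"

definition LCstar_topology :: "'a::involutive_algebra topology \<Rightarrow> bool" where
  "LCstar_topology t \<longleftrightarrow> (\<exists>P. (\<forall>p\<in>P. Cstar_seminorm p) \<and> t = seminorms_topology P)"

definition continuous_hermitian_characters ::
    "'a::involutive_algebra topology \<Rightarrow> ('a \<Rightarrow> complex) set" where
  "continuous_hermitian_characters t =
     {\<phi> \<in> hermitian_characters. continuous_map t euclidean \<phi>}"

definition compatible_LCstar_topologies ::
    "('a::involutive_algebra \<Rightarrow> complex) set \<Rightarrow> 'a topology set" where
  "compatible_LCstar_topologies \<Gamma> =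
     {t. LCstar_topology t \<and> continuous_hermitian_characters t = \<Gamma>}"

text \<open>The seminorm \<open>p\<^sup>K\<close>. The supremum over the empty set, taken among nonnegative numbers, is
  \<open>0\<close>; the real-valued \<open>Sup {}\<close> is unspecified.\<close>

definition sup_seminorm ::
    "('a::involutive_algebra \<Rightarrow> complex) set \<Rightarrow> 'a \<Rightarrow> real" where
  "sup_seminorm K a = (if K = {} then 0 else (SUP \<phi>\<in>K. cmod (\<phi> a)))"

definition uniform_convergence_topology ::
    "('a::involutive_algebra \<Rightarrow> complex) set set \<Rightarrow> 'a topology" where
  "uniform_convergence_topology B = seminorms_topology (sup_seminorm ` B)"

definition weaker_topology :: "'a topology \<Rightarrow> 'a topology \<Rightarrow> bool" where
  "weaker_topology s t \<longleftrightarrow> (\<forall>U. openin s U \<longrightarrow> openin t U)"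

definition weakest_topology_in :: "'a topology set \<Rightarrow> 'a topology \<Rightarrow> bool" where
  "weakest_topology_in T s \<longleftrightarrow> s \<in> T \<and> (\<forall>t\<in>T. weaker_topology s t)"

definition strongest_topology_in :: "'a topology set \<Rightarrow> 'a topology \<Rightarrow> bool" where
  "strongest_topology_in T s \<longleftrightarrow> s \<in> T \<and> (\<forall>t\<in>T. weaker_topology t s)"

definition continuous_Cstar_seminorm ::
    "'a::involutive_algebra topology \<Rightarrow> ('a \<Rightarrow> real) \<Rightarrow> bool" where
  "continuous_Cstar_seminorm t p \<longleftrightarrow> Cstar_seminorm p \<and> continuous_map t euclideanreal p"

definition minimal_continuous_Cstar_seminorm ::
    "'a::involutive_algebra topology \<Rightarrow> ('a \<Rightarrow> real) \<Rightarrow> bool" where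
  "minimal_continuous_Cstar_seminorm t p \<longleftrightarrow>
     continuous_Cstar_seminorm t p \<and> p \<noteq> (\<lambda>_. 0) \<and>
     (\<forall>q. continuous_Cstar_seminorm t q \<and> q \<noteq> (\<lambda>_. 0) \<and> (\<forall>x. q x \<le> p x) \<longrightarrow> q = p)"

end

theory Submission
  imports Defs
begin

text \<open>
  On a commutative algebra, a C*-seminorm \<open>p\<close> is the supremum of \<open>|\<phi>|\<close> over the compact set \<open>K\<close>
  of all hermitian characters \<open>\<phi>\<close> with \<open>|\<phi>| \<le> p\<close>. No completion or spectral theory is needed:
  for selfadjoint \<open>b\<close> with \<open>p b \<noteq> 0\<close>, the limit of \<open>p (b^n x) / p(b)^n\<close> is again a C*-seminorm, below
  \<open>p\<close> and multiplicative with respect to \<open>b\<close>. Hence a C*-seminorm that is minimal among those below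
  \<open>p\<close> with this property is multiplicative, and by the Gelfand-Mazur argument it is the modulus of a
  hermitian character, whose value at \<open>b\<close> has modulus \<open>p b\<close>.

  Conversely, a hermitian character dominated by the supremum seminorm of a compact set of hermitian
  characters belongs to that set. Since a C*-seminorm is continuous iff it is at most the maximum of
  finitely many defining C*-seminorms, compatible topologies correspond to collections of compact
  subsets of \<open>\<Gamma>\<close> covering \<open>\<Gamma>\<close>, and the minimal continuous C*-seminorms are the moduli of the
  elements of \<open>\<Gamma>\<close>.
\<close>

section \<open>Elementary rules for scalars, the involution and seminorms\<close>

lemma scaleC_zero_left [simp]: "0 *\<^sub>C x = (0::'a::involutive_algebra)"
  using scaleC_add_left[of 0 0 x] by simp

lemma scaleC_uminus_left: "(- c) *\<^sub>C x = - (c *\<^sub>C (x::'a::involutive_algebra))"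
  using scaleC_add_left[of c "- c" x] by (simp add: eq_neg_iff_add_eq_0 add.commute)

lemma mult_scaleC_right: "x * c *\<^sub>C y = c *\<^sub>C (x * (y::'a::involutive_algebra))"
  by (metis mult.commute mult_scaleC_left)

lemma star_one [simp]: "star (1::'a::involutive_algebra) = 1"
  by (metis mult.right_neutral star_mult star_star)

lemma star_uminus: "star (- x) = - star (x::'a::involutive_algebra)"
  using star_scaleC[of "-1" x] by (simp add: scaleC_uminus_left scaleC_one)

lemma star_diff: "star (x - y) = star x - star (y::'a::involutive_algebra)"
  using star_add[of x "- y"] by (simp add: star_uminus)

lemma star_power: "star (x ^ n) = star (x::'a::involutive_algebra) ^ n"
  by (induction n) (simp_all add: star_mult mult.commute)

lemma seminormD:
  assumes "seminorm p"
  shows seminorm_nonneg: "0 \<le> p x"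
    and seminorm_triangle: "p (x + y) \<le> p x + p y"
    and seminorm_scaleC: "p (c *\<^sub>C x) = cmod c * p x"
  using assms unfolding seminorm_def by auto

lemma seminorm_zero: "seminorm p \<Longrightarrow> p 0 = 0"
  using seminorm_scaleC[of p 0 0] by simp

lemma seminorm_uminus: "seminorm p \<Longrightarrow> p (- x) = p x"
  using seminorm_scaleC[of p "-1" x] by (simp add: scaleC_uminus_left scaleC_one)

lemma seminorm_minus_commute: "seminorm p \<Longrightarrow> p (x - y) = p (y - x)"
  using seminorm_uminus[of p "x - y"] by simp

lemma seminorm_triangle_diff: "seminorm p \<Longrightarrow> p (x - y) \<le> p x + p y"
  using seminorm_triangle[of p x "- y"] by (simp add: seminorm_uminus)

lemma seminorm_reverse_triangle: "seminorm p \<Longrightarrow> \<bar>p x - p y\<bar> \<le> p (x - y)"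
  using seminorm_triangle[of p "x - y" y] seminorm_triangle[of p "y - x" x]
    seminorm_minus_commute[of p x y] by simp

lemma seminorm_ball_triangle:
  assumes "seminorm p" shows "p (x - z) \<le> p (x - y) + p (y - z)"
  using seminorm_triangle[OF assms, of "x - y" "y - z"] by simp

subsection \<open>Submultiplicativity of C*-seminorms\<close>

text \<open>If \<open>b < a\<close>, the powers of \<open>a / b\<close> exceed every constant. So a
  bound with a factor \<open>C\<close>, once available along the exponents \<open>2 ^ n\<close>,
  improves to the bound without it.\<close>

lemma le_of_power_two_power_bounded:
  fixes a b C :: real
  assumes "0 \<le> b" and *: "\<And>n::nat. a ^ (2 ^ n) \<le> C * b ^ (2 ^ n)"
  shows "a \<le> b"
proof (rule ccontr)
  assume "\<not> a \<le> b"
  then have "b < a" "0 < a" using assms(1) by auto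
  show False
  proof (cases "b = 0")
    case True
    then show False using *[of 0] \<open>0 < a\<close> by simp
  next
    case False
    then have b: "0 < b" using assms(1) by simp
    define r where "r = a / b"
    have r: "1 < r" using b \<open>b < a\<close> by (simp add: r_def)
    have le: "r ^ (2 ^ n) \<le> C" for n :: nat
      using *[of n] b by (simp add: r_def power_divide field_simps)
    obtain N where N: "C < r ^ N" using real_arch_pow[OF r] by blast
    have "N \<le> 2 ^ N" by (simp add: less_imp_le)
    then have "r ^ N \<le> r ^ (2 ^ N)" using r by (intro power_increasing) auto
    then show False using N le[of N] by simp
  qed
qed

lemma Cstar_seminorm_imp_seminorm: "Cstar_seminorm p \<Longrightarrow> seminorm p"
  by (simp add: Cstar_seminorm_def)

lemma Cstar_seminorm_mult_star: "Cstar_seminorm p \<Longrightarrow> p (x * star x) = (p x)\<^sup>2"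
  by (simp add: Cstar_seminorm_def)

text \<open>Commutativity identifies \<open>x * star x\<close> with \<open>star x * x\<close>, so
  the C*-identity gives both values the same square.\<close>

lemma Cstar_seminorm_star:
  assumes "Cstar_seminorm p" shows "p (star x) = p x"
proof -
  have "(p (star x))\<^sup>2 = (p x)\<^sup>2"
    using Cstar_seminorm_mult_star[OF assms, of x] Cstar_seminorm_mult_star[OF assms, of "star x"]
    by (simp add: star_star mult.commute)
  then show ?thesis
    using seminorm_nonneg[OF Cstar_seminorm_imp_seminorm[OF assms]] by (simp add: power2_eq_iff_nonneg)
qed

text \<open>For selfadjoint elements the C*-identity says that \<open>p\<close> commutes with
  squaring; iterate.\<close>

lemma Cstar_seminorm_selfadjoint_power_two_power:
  assumes "Cstar_seminorm p" "star x = x"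
  shows "p (x ^ (2 ^ n)) = p x ^ (2 ^ n)"
proof (induction n)
  case (Suc n)
  have "p (x ^ 2 ^ Suc n) = p (x ^ 2 ^ n * star (x ^ 2 ^ n))"
    by (simp add: star_power assms(2) flip: power_add mult_2)
  also have "\<dots> = p x ^ 2 ^ Suc n"
    by (simp add: Cstar_seminorm_mult_star[OF assms(1)] Suc.IH power_mult[symmetric] mult.commute)
  finally show ?case .
qed simp

text \<open>Let \<open>e\<close> tend to 0 from above in \<open>(a + e) * (b + e)\<close>. For
  nonnegative \<open>a\<close> and \<open>b\<close> the strict bounds are positive, so they can
  serve as divisors even when \<open>a\<close> or \<open>b\<close> vanishes.\<close>

lemma le_mult_of_strict_bounds:
  fixes a b c :: real
  assumes "\<And>u v. a < u \<Longrightarrow> b < v \<Longrightarrow> c \<le> u * v"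
  shows "c \<le> a * b"
proof -
  have "((\<lambda>e. (a + e) * (b + e)) \<longlongrightarrow> (a + 0) * (b + 0)) (at_right 0)"
    by (intro tendsto_intros)
  moreover have "eventually (\<lambda>e. c \<le> (a + e) * (b + e)) (at_right 0)"
    using assms by (intro eventually_at_rightI[of 0 1]) auto
  ultimately show ?thesis
    using tendsto_lowerbound[of "\<lambda>e. (a + e) * (b + e)" "a * b" "at_right 0" c] by simp
qed

text \<open>The polarization identity gives the crude bound 2 on the selfadjoint part of the unit
  ball. Applied to \<open>h ^ 2 ^ n\<close> and \<open>k ^ 2 ^ n\<close> it bounds
  \<open>p (h * k) ^ 2 ^ n\<close> by 2 for every \<open>n\<close>, which forces
  \<open>p (h * k)\<close> to be at most 1.\<close>

lemma Cstar_seminorm_mult_selfadjoint_le_one: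
  assumes p: "Cstar_seminorm p" and h: "star h = h" "p h \<le> 1" and k: "star k = k" "p k \<le> 1"
  shows "p (h * k) \<le> 1"
proof -
  note sn = Cstar_seminorm_imp_seminorm[OF p]
  have bound: "p (h * k) \<le> 2" if h: "star h = h" "p h \<le> 1" and k: "star k = k" "p k \<le> 1" for h k
  proof -
    have eq: "4 *\<^sub>C (h * k) = (h + k) * star (h + k) - (h - k) * star (h - k)"
    proof -
      have "(h * k) + (h * k) + (h * k) + (h * k) = 4 *\<^sub>C (h * k)"
        using scaleC_add_left[of 1 1 "h*k"] scaleC_add_left[of 2 1 "h*k"] scaleC_add_left[of 3 1 "h*k"]
        by (simp add: scaleC_one)
      then show ?thesis by (simp add: star_add star_diff h k algebra_simps)
    qed
    have "4 * p (h * k) = p (4 *\<^sub>C (h * k))" by (simp add: seminorm_scaleC[OF sn])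
    also have "\<dots> \<le> (p (h + k))\<^sup>2 + (p (h - k))\<^sup>2"
      unfolding eq using seminorm_triangle_diff[OF sn] by (metis Cstar_seminorm_mult_star[OF p])
    also have "\<dots> \<le> 2\<^sup>2 + 2\<^sup>2"
      using seminorm_triangle[OF sn, of h k] seminorm_triangle_diff[OF sn, of h k] that
        seminorm_nonneg[OF sn] by (intro add_mono power_mono) auto
    finally show ?thesis by simp
  qed
  have "p (h * k) ^ 2 ^ n \<le> 2 * 1 ^ 2 ^ n" for n :: nat
  proof -
    have "p (h * k) ^ 2 ^ n = p (h ^ 2 ^ n * k ^ 2 ^ n)"
      using Cstar_seminorm_selfadjoint_power_two_power[OF p, of "h * k" n]
      by (simp add: star_mult h k power_mult_distrib mult.commute)
    also have "\<dots> \<le> 2"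
      using h k seminorm_nonneg[OF sn]
      by (intro bound) (simp_all add: star_power Cstar_seminorm_selfadjoint_power_two_power[OF p] power_le_one)
    finally show ?thesis by simp
  qed
  then show ?thesis by (rule le_of_power_two_power_bounded[rotated]) simp
qed

text \<open>Rescaling by strict upper bounds \<open>u\<close> and \<open>v\<close> of
  \<open>p h\<close> and \<open>p k\<close> reduces to the unit ball without dividing by
  zero.\<close>

lemma Cstar_seminorm_mult_selfadjoint:
  assumes p: "Cstar_seminorm p" and h: "star h = h" and k: "star k = k"
  shows "p (h * k) \<le> p h * p k"
proof (rule le_mult_of_strict_bounds)
  fix u v :: real
  assume uv: "p h < u" "p k < v"
  note sn = Cstar_seminorm_imp_seminorm[OF p]
  have pos: "0 < u" "0 < v" using uv seminorm_nonneg[OF sn, of h] seminorm_nonneg[OF sn, of k] by auto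
  have "p ((of_real (1/u) *\<^sub>C h) * (of_real (1/v) *\<^sub>C k)) \<le> 1"
    using uv pos by (intro Cstar_seminorm_mult_selfadjoint_le_one[OF p])
      (simp_all add: star_scaleC h k seminorm_scaleC[OF sn] norm_divide)
  then show "p (h * k) \<le> u * v"
    using pos by (simp add: mult_scaleC_left mult_scaleC_right seminorm_scaleC[OF sn] norm_divide field_simps)
qed

lemma star_mult_star: "star (x * star x) = (x::'a::involutive_algebra) * star x"
  by (simp add: star_mult star_star)

text \<open>By commutativity \<open>x * y\<close> times its adjoint is the product on the right.
  This reduces statements about products to selfadjoint factors.\<close>

lemma Cstar_seminorm_mult_square:
  assumes p: "Cstar_seminorm p"
  shows "(p (x * y))\<^sup>2 = p ((x * star x) * (y * star y))"
  by (simp add: Cstar_seminorm_mult_star[OF p, symmetric] star_mult mult_ac)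

lemma Cstar_seminorm_mult:
  assumes p: "Cstar_seminorm p"
  shows "p (x * y) \<le> p x * p y"
proof -
  have "(p (x * y))\<^sup>2 \<le> (p x * p y)\<^sup>2"
    unfolding Cstar_seminorm_mult_square[OF p]
    using Cstar_seminorm_mult_selfadjoint[OF p star_mult_star star_mult_star, of x y]
    by (simp add: Cstar_seminorm_mult_star[OF p] power_mult_distrib)
  then show ?thesis
    using seminorm_nonneg[OF Cstar_seminorm_imp_seminorm[OF p]] by (meson power2_le_imp_le mult_nonneg_nonneg)
qed

text \<open>The C*-identity at 1 leaves only the values 0 and 1, and submultiplicativity excludes 0
  for nonzero \<open>p\<close>.\<close>

lemma Cstar_seminorm_one:
  assumes p: "Cstar_seminorm p" and nz: "p \<noteq> (\<lambda>_. 0)"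
  shows "p 1 = 1"
proof -
  obtain x where x: "p x \<noteq> 0" using nz by auto
  have "p x \<le> p 1 * p x" using Cstar_seminorm_mult[OF p, of 1 x] by simp
  then have "p 1 \<noteq> 0"
    using x seminorm_nonneg[OF Cstar_seminorm_imp_seminorm[OF p], of x] by auto
  then show ?thesis using Cstar_seminorm_mult_star[OF p, of 1] by (simp add: power2_eq_square)
qed

text \<open>Submultiplicativity gives \<le>. For \<ge>, the exponent is padded up to
  \<open>2 ^ n\<close>, where equality is known, and the extra power of \<open>p x\<close> is
  cancelled.\<close>

lemma Cstar_seminorm_selfadjoint_power:
  assumes p: "Cstar_seminorm p" and nz: "p x \<noteq> 0" and x: "star x = x"
  shows "p (x ^ n) = p x ^ n"
proof (rule antisym)
  note sn = Cstar_seminorm_imp_seminorm[OF p]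
  have one: "p 1 = 1" using Cstar_seminorm_one[OF p] nz by auto
  show le: "p (x ^ n) \<le> p x ^ n" for n
  proof (induction n)
    case (Suc n)
    have "p (x ^ Suc n) \<le> p x * p (x ^ n)" using Cstar_seminorm_mult[OF p] by simp
    also have "\<dots> \<le> p x * p x ^ n" using Suc.IH seminorm_nonneg[OF sn] by (intro mult_left_mono)
    finally show ?case by simp
  qed (simp add: one)
  \<comment> \<open>Since \<open>n < 2 ^ n\<close>, the subtraction does not truncate and
    \<open>n + m\<close> is a power of two.\<close>
  define m :: nat where "m = 2 ^ n - n"
  have m: "2 ^ n = n + m" by (simp add: m_def less_imp_le)
  have pos: "0 < p x" using nz seminorm_nonneg[OF sn, of x] by simp
  have "p x ^ n * p x ^ m = p (x ^ n * x ^ m)"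
    using Cstar_seminorm_selfadjoint_power_two_power[OF p x, of n] by (simp add: m power_add)
  also have "\<dots> \<le> p (x ^ n) * p (x ^ m)" by (rule Cstar_seminorm_mult[OF p])
  also have "\<dots> \<le> p (x ^ n) * p x ^ m" using le seminorm_nonneg[OF sn] by (intro mult_left_mono)
  finally show "p x ^ n \<le> p (x ^ n)" using pos by simp
qed

lemma Cstar_seminorm_power_two_power:
  assumes p: "Cstar_seminorm p"
  shows "p ((x * star x) ^ 2 ^ n) = (p x ^ 2 ^ n)\<^sup>2"
  using Cstar_seminorm_selfadjoint_power_two_power[OF p star_mult_star]
  by (simp add: Cstar_seminorm_mult_star[OF p] mult.commute flip: power_mult)

lemma Cstar_seminorm_le_of_le_scaled:
  assumes p: "Cstar_seminorm p" and q: "Cstar_seminorm q" and le: "\<And>x. q x \<le> C * p x"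
  shows "q x \<le> p x"
proof -
  have "(q x)\<^sup>2 \<le> (p x)\<^sup>2"
  proof (rule le_of_power_two_power_bounded)
    show "((q x)\<^sup>2) ^ 2 ^ n \<le> C * ((p x)\<^sup>2) ^ 2 ^ n" for n :: nat
      using le[of "(x * star x) ^ 2 ^ n"]
      by (simp add: Cstar_seminorm_power_two_power[OF p] Cstar_seminorm_power_two_power[OF q] mult.commute flip: power_mult)
  qed simp
  then show ?thesis
    using seminorm_nonneg[OF Cstar_seminorm_imp_seminorm[OF p]] by (meson power2_le_imp_le)
qed

subsection \<open>Localization and multiplicative C*-seminorms\<close>

text \<open>With \<open>p\<close> viewed as a supremum of moduli of characters and
  \<open>p b \<noteq> 0\<close>, this is the supremum over those with
  \<open>cmod (\<phi> b) = p b\<close>: the factors \<open>(cmod (\<phi> b) / p b) ^ n\<close> of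
  the others tend to 0.\<close>

definition localized_seminorm :: "('a::involutive_algebra \<Rightarrow> real) \<Rightarrow> 'a \<Rightarrow> 'a \<Rightarrow> real" where
  "localized_seminorm p b x = lim (\<lambda>n. p (b ^ n * x) / p b ^ n)"

text \<open>The sequence is nonnegative and, by submultiplicativity, decreasing; its term at
  \<open>n = 0\<close> is \<open>p x\<close>.\<close>

lemma localized_seminorm_LIMSEQ:
  assumes p: "Cstar_seminorm p" and nz: "p b \<noteq> 0"
  shows "(\<lambda>n. p (b ^ n * x) / p b ^ n) \<longlonglongrightarrow> localized_seminorm p b x"
    and "localized_seminorm p b x \<le> p x"
proof -
  note sn = Cstar_seminorm_imp_seminorm[OF p]
  let ?s = "\<lambda>n. p (b ^ n * x) / p b ^ n"
  have pos: "0 < p b" using nz seminorm_nonneg[OF sn, of b] by simp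
  have dec: "decseq ?s"
  proof (rule decseq_SucI)
    fix n
    have "p (b ^ Suc n * x) \<le> p b * p (b ^ n * x)"
      using Cstar_seminorm_mult[OF p, of b "b ^ n * x"] by (simp add: mult.assoc)
    then show "?s (Suc n) \<le> ?s n" using pos by (simp add: field_simps)
  qed
  have "\<And>n. 0 \<le> ?s n" using pos seminorm_nonneg[OF sn] by simp
  with dec obtain L where "?s \<longlonglongrightarrow> L" using decseq_convergent[of ?s 0] by blast
  then show *: "?s \<longlonglongrightarrow> localized_seminorm p b x"
    unfolding localized_seminorm_def by (simp add: limI)
  show "localized_seminorm p b x \<le> p x" using decseq_ge[OF dec *, of 0] by simp
qed

text \<open>The factor \<open>\<gamma>\<close> comes out of every term. A scalar \<open>c\<close>
  gives homogeneity of the limit; a general \<open>c\<close> shows that localizing at one element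
  keeps multiplicativity with respect to another.\<close>

lemma localized_seminorm_mult:
  assumes p: "Cstar_seminorm p" and nz: "p b \<noteq> 0" and c: "\<And>x. p (c * x) = \<gamma> * p x"
  shows "localized_seminorm p b (c * x) = \<gamma> * localized_seminorm p b x"
proof (rule LIMSEQ_unique[OF localized_seminorm_LIMSEQ(1)[OF p nz]])
  show "(\<lambda>n. p (b ^ n * (c * x)) / p b ^ n) \<longlonglongrightarrow> \<gamma> * localized_seminorm p b x"
    using tendsto_mult_left[OF localized_seminorm_LIMSEQ(1)[OF p nz], of \<gamma> x]
    by (simp add: mult.left_commute[of "b ^ _" c] c)
qed

lemma Cstar_seminorm_localized:
  assumes p: "Cstar_seminorm p" and nz: "p b \<noteq> 0" and b: "star b = b"
  shows "Cstar_seminorm (localized_seminorm p b)"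
    and "localized_seminorm p b 1 = 1"
    and "localized_seminorm p b (b * x) = p b * localized_seminorm p b x"
proof -
  note sn = Cstar_seminorm_imp_seminorm[OF p]
  note lim = localized_seminorm_LIMSEQ(1)[OF p nz]
  have pos: "0 < p b" using nz seminorm_nonneg[OF sn, of b] by simp
  have "seminorm (localized_seminorm p b)"
    unfolding seminorm_def
  proof (intro conjI allI)
    show "0 \<le> localized_seminorm p b x" for x
      using pos seminorm_nonneg[OF sn] by (intro LIMSEQ_le_const[OF lim]) auto
    show "localized_seminorm p b (x + y) \<le> localized_seminorm p b x + localized_seminorm p b y" for x y
      using pos seminorm_triangle[OF sn]
      by (intro LIMSEQ_le[OF lim tendsto_add[OF lim lim]])
        (auto simp: distrib_left add_divide_distrib[symmetric] divide_right_mono)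
    show "localized_seminorm p b (c *\<^sub>C x) = cmod c * localized_seminorm p b x" for c x
      using localized_seminorm_mult[OF p nz, of "c *\<^sub>C 1" "cmod c" x]
      by (simp add: mult_scaleC_left seminorm_scaleC[OF sn])
  qed
  moreover have "localized_seminorm p b (x * star x) = (localized_seminorm p b x)\<^sup>2" for x
  proof (rule LIMSEQ_unique)
    show "(\<lambda>n. (p (b ^ n * x) / p b ^ n)\<^sup>2) \<longlonglongrightarrow> (localized_seminorm p b x)\<^sup>2"
      by (intro tendsto_power lim)
    \<comment> \<open>As \<open>b ^ n\<close> is selfadjoint, the square of term \<open>n\<close>
      for \<open>x\<close> is term \<open>2 * n\<close> for \<open>x * star x\<close>, and the even
      subsequence has the same limit.\<close>
    have "(p (b ^ n * x) / p b ^ n)\<^sup>2 = p (b ^ (2 * n) * (x * star x)) / p b ^ (2 * n)" for n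
      unfolding power_divide Cstar_seminorm_mult_square[OF p]
      by (simp add: star_power b mult.commute flip: power_add power_mult mult_2)
    then show "(\<lambda>n. (p (b ^ n * x) / p b ^ n)\<^sup>2) \<longlonglongrightarrow> localized_seminorm p b (x * star x)"
      using LIMSEQ_subseq_LIMSEQ[OF lim, of "\<lambda>n. 2 * n" "x * star x"]
      by (simp add: o_def strict_mono_def)
  qed
  ultimately show "Cstar_seminorm (localized_seminorm p b)" by (simp add: Cstar_seminorm_def)
  \<comment> \<open>All terms are 1 because \<open>p (b ^ n) = p b ^ n\<close>; so the localization
    is not the zero seminorm.\<close>
  show "localized_seminorm p b 1 = 1"
    by (rule LIMSEQ_unique[OF lim]) (simp add: Cstar_seminorm_selfadjoint_power[OF p nz b] nz)
  show "localized_seminorm p b (b * x) = p b * localized_seminorm p b x"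
  proof (rule LIMSEQ_unique[OF lim])
    \<comment> \<open>Multiplying by \<open>b\<close> shifts the index by one, which costs exactly
      the factor \<open>p b\<close>.\<close>
    have "p (b ^ n * (b * x)) / p b ^ n = p b * (p (b ^ Suc n * x) / p b ^ Suc n)" for n
      using pos by (simp add: mult_ac)
    then show "(\<lambda>n. p (b ^ n * (b * x)) / p b ^ n) \<longlonglongrightarrow> p b * localized_seminorm p b x"
      using tendsto_mult_left[OF LIMSEQ_Suc[OF lim], of "p b" x] by simp
  qed
qed

section \<open>Infima of chains and minimal C*-seminorms\<close>

lemma INF_mult_left_nonneg:
  fixes f :: "'b \<Rightarrow> real"
  assumes "S \<noteq> {}" "0 \<le> \<gamma>" "\<And>r. r \<in> S \<Longrightarrow> 0 \<le> f r"
  shows "(INF r\<in>S. \<gamma> * f r) = \<gamma> * (INF r\<in>S. f r)"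
proof (cases "\<gamma> = 0")
  case False
  have bdd: "bdd_below (f ` S)" "bdd_below ((\<lambda>r. \<gamma> * f r) ` S)"
    using assms by (auto intro!: bdd_belowI2[where m = 0])
  show ?thesis
  proof (rule antisym)
    have "(INF r\<in>S. \<gamma> * f r) / \<gamma> \<le> (INF r\<in>S. f r)"
      using assms False by (intro cINF_greatest) (auto simp: field_simps intro!: cINF_lower bdd)
    then show "(INF r\<in>S. \<gamma> * f r) \<le> \<gamma> * (INF r\<in>S. f r)" using assms False by (simp add: field_simps)
    show "\<gamma> * (INF r\<in>S. f r) \<le> (INF r\<in>S. \<gamma> * f r)"
      using assms by (intro cINF_greatest mult_left_mono cINF_lower bdd)
  qed
qed (use assms in simp)

text \<open>The chain condition serves the triangle inequality: the smaller of \<open>r\<close> and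
  \<open>s\<close> bounds \<open>r x + s y\<close> from below. Pointwise infima of arbitrary
  families need not be subadditive.\<close>

lemma Cstar_seminorm_INF_chain:
  fixes C :: "('a::involutive_algebra \<Rightarrow> real) set"
  assumes "C \<noteq> {}" and Cstar: "\<And>r. r \<in> C \<Longrightarrow> Cstar_seminorm r"
    and chain: "\<And>r s. r \<in> C \<Longrightarrow> s \<in> C \<Longrightarrow> r \<le> s \<or> s \<le> r"
  shows "Cstar_seminorm (\<lambda>x. INF r\<in>C. r x)"
    and "\<And>r x. r \<in> C \<Longrightarrow> (INF r\<in>C. r x) \<le> r x"
proof -
  note nonneg = seminorm_nonneg[OF Cstar_seminorm_imp_seminorm[OF Cstar]]
  let ?q = "\<lambda>x. INF r\<in>C. r x"
  have bdd: "bdd_below ((\<lambda>r. r x) ` C)" for x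
    using nonneg by (auto intro!: bdd_belowI2[where m = 0])
  show lower: "?q x \<le> r x" if "r \<in> C" for r x
    using that by (intro cINF_lower bdd)
  have q0: "0 \<le> ?q x" for x
    using nonneg assms(1) by (intro cINF_greatest) auto
  have "seminorm ?q"
    unfolding seminorm_def
  proof (intro conjI allI)
    fix x y
    have "?q (x + y) \<le> r x + s y" if rs: "r \<in> C" "s \<in> C" for r s
    proof -
      obtain u where u: "u \<in> C" "u \<le> r" "u \<le> s" using chain[of r s] rs by (metis order_refl)
      have "?q (x + y) \<le> u x + u y"
        using lower[OF u(1)] seminorm_triangle[OF Cstar_seminorm_imp_seminorm[OF Cstar[OF u(1)]]]
        by (rule order_trans)
      also have "\<dots> \<le> r x + s y" using u by (intro add_mono) (auto simp: le_fun_def)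
      finally show ?thesis .
    qed
    then have "?q (x + y) - r x \<le> s y" if "r \<in> C" "s \<in> C" for r s
      using that by (simp add: diff_le_eq add.commute)
    then have "?q (x + y) - r x \<le> ?q y" if "r \<in> C" for r
      using assms(1) that by (intro cINF_greatest)
    then have "?q (x + y) - ?q y \<le> r x" if "r \<in> C" for r
      using that by (simp add: diff_le_eq add.commute)
    then have "?q (x + y) - ?q y \<le> ?q x"
      using assms(1) by (intro cINF_greatest)
    then show "?q (x + y) \<le> ?q x + ?q y" by simp
  next
    fix c x
    have "?q (c *\<^sub>C x) = (INF r\<in>C. cmod c * r x)"
      using Cstar by (intro INF_cong) (simp_all add: seminorm_scaleC Cstar_seminorm_imp_seminorm)
    then show "?q (c *\<^sub>C x) = cmod c * ?q x"
      by (simp add: INF_mult_left_nonneg[OF assms(1)] nonneg)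
  qed (rule q0)
  moreover have "?q (x * star x) = (?q x)\<^sup>2" for x
  proof (rule antisym)
    show "(?q x)\<^sup>2 \<le> ?q (x * star x)"
      using assms(1) by (intro cINF_greatest)
        (auto simp: Cstar_seminorm_mult_star[OF Cstar] intro!: power_mono lower q0)
    have "sqrt (?q (x * star x)) \<le> r x" if "r \<in> C" for r
      using real_sqrt_le_mono[OF lower[OF that, of "x * star x"]] nonneg[OF that, of x]
      by (simp add: Cstar_seminorm_mult_star[OF Cstar[OF that]])
    then have "sqrt (?q (x * star x)) \<le> ?q x"
      using assms(1) by (intro cINF_greatest) auto
    then show "?q (x * star x) \<le> (?q x)\<^sup>2" by (simp add: sqrt_le_D)
  qed
  ultimately show "Cstar_seminorm ?q" by (simp add: Cstar_seminorm_def)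
qed

lemma exists_multiplicative_Cstar_seminorm:
  fixes p :: "'a::involutive_algebra \<Rightarrow> real"
  assumes p: "Cstar_seminorm p" and nz: "p b \<noteq> 0" and b: "star b = b"
  obtains q where "Cstar_seminorm q" "q \<le> p" "q b = p b" "q 1 = 1" "\<And>x y. q (x * y) = q x * q y"
proof -
  \<comment> \<open>The condition \<open>q 1 = 1\<close> survives infima of chains and keeps out the
    zero seminorm; with the last condition at \<open>x = 1\<close> it yields
    \<open>q b = p b\<close>.\<close>
  define S where "S = {q. Cstar_seminorm q \<and> q \<le> p \<and> q 1 = 1 \<and> (\<forall>x. q (b * x) = p b * q x)}"
  have p_b: "localized_seminorm p b \<in> S"
    using Cstar_seminorm_localized[OF p nz b] localized_seminorm_LIMSEQ(2)[OF p nz]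
    by (simp add: S_def le_fun_def)
  have "\<exists>m\<in>S. \<forall>a\<in>S. a \<le> m \<longrightarrow> a = m"
  \<comment> \<open>The order is reversed, so the maximal element of Zorn's lemma is a minimal
    seminorm.\<close>
  proof (rule predicate_Zorn)
    show "partial_order_on S (relation_of (\<lambda>x y. y \<le> x) S)"
      by (rule partial_order_on_relation_ofI) auto
  next
    fix C
    assume C: "C \<in> Chains (relation_of (\<lambda>x y. y \<le> x) S)"
    then have CS: "C \<subseteq> S" by (rule Chains_relation_of)
    show "\<exists>u\<in>S. \<forall>a\<in>C. u \<le> a"
    proof (cases "C = {}")
      case False
      have chain: "\<And>r s. r \<in> C \<Longrightarrow> s \<in> C \<Longrightarrow> r \<le> s \<or> s \<le> r"
        using C unfolding Chains_def relation_of_def by blast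
      have Cstar: "\<And>r. r \<in> C \<Longrightarrow> Cstar_seminorm r" using CS by (auto simp: S_def)
      let ?q = "\<lambda>x. INF r\<in>C. r x"
      have inf: "Cstar_seminorm ?q" "\<And>r x. r \<in> C \<Longrightarrow> ?q x \<le> r x"
        by (rule Cstar_seminorm_INF_chain[OF False]; use Cstar chain in blast)+
      obtain r0 where "r0 \<in> C" using False by blast
      then have "r0 x \<le> p x" for x using CS by (auto simp: S_def le_fun_def)
      then have "?q x \<le> p x" for x using inf(2)[OF \<open>r0 \<in> C\<close>] by (rule order_trans[rotated])
      moreover have "?q 1 = (INF r\<in>C. 1)"
        using CS by (intro INF_cong) (auto simp: S_def)
      moreover have "?q (b * x) = p b * ?q x" for x
      proof -
        have "?q (b * x) = (INF r\<in>C. p b * r x)"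
          using CS by (intro INF_cong) (auto simp: S_def)
        then show ?thesis
          by (simp add: INF_mult_left_nonneg[OF False] seminorm_nonneg Cstar_seminorm_imp_seminorm p Cstar)
      qed
      ultimately have "?q \<in> S" using inf(1) False by (simp add: S_def le_fun_def)
      then show ?thesis using inf(2) by (intro bexI[of _ ?q] ballI le_funI)
    qed (use p_b in auto)
  qed
  then obtain q where "q \<in> S" and min: "\<And>r. r \<in> S \<Longrightarrow> r \<le> q \<Longrightarrow> r = q" by blast
  then have q: "Cstar_seminorm q" "q \<le> p" "q 1 = 1" and qb: "\<And>x. q (b * x) = p b * q x"
    by (auto simp: S_def)
  note sn = Cstar_seminorm_imp_seminorm[OF q(1)]
  have mult: "q (c * x) = q c * q x" if c: "star c = c" for c x
  proof (cases "q c = 0")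
    case True
    then show ?thesis
      using Cstar_seminorm_mult[OF q(1), of c x] seminorm_nonneg[OF sn, of "c * x"] by simp
  next
    case False
    note loc = Cstar_seminorm_localized[OF q(1) False c] localized_seminorm_LIMSEQ(2)[OF q(1) False]
    \<comment> \<open>The localization of \<open>q\<close> at \<open>c\<close> lies in
      \<open>S\<close> and below \<open>q\<close>, so minimality makes it equal to \<open>q\<close>,
      which is therefore multiplicative with respect to \<open>c\<close>.\<close>
    have le: "localized_seminorm q c \<le> q" using loc by (simp add: le_fun_def)
    then have "localized_seminorm q c \<in> S"
      using loc q(2) localized_seminorm_mult[OF q(1) False qb] by (auto simp: S_def)
    then have "localized_seminorm q c = q" using min le by blast
    then show ?thesis using loc(3)[of x] by simp
  qed
  show thesis
  proof (rule that[OF q(1,2) _ q(3)])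
    show "q b = p b" using qb[of 1] q(3) by simp
    fix x y
    \<comment> \<open>After squaring, both factors are selfadjoint, so \<open>mult\<close> applies
      to arbitrary \<open>x\<close> and \<open>y\<close>.\<close>
    have "(q (x * y))\<^sup>2 = (q x * q y)\<^sup>2"
      unfolding Cstar_seminorm_mult_square[OF q(1)]
      by (simp add: mult star_mult_star Cstar_seminorm_mult_star[OF q(1)] power_mult_distrib)
    then show "q (x * y) = q x * q y"
      using seminorm_nonneg[OF sn] by (simp add: power2_eq_iff_nonneg)
  qed
qed

section \<open>The Gelfand-Mazur argument for multiplicative seminorms\<close>

text \<open>A complex square root of \<open>c\<close> splits the difference into two differences
  with exponent \<open>2 ^ n\<close>. Hence the induction runs over all \<open>c\<close> at
  once.\<close>

lemma multiplicative_seminorm_power_two_power_diff_ge: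
  fixes q :: "'a::involutive_algebra \<Rightarrow> real"
  assumes mult: "\<And>x y. q (x * y) = q x * q y"
    and "0 \<le> m" and min: "\<And>c. m \<le> q (y - c *\<^sub>C 1)"
  shows "m ^ 2 ^ n \<le> q (y ^ 2 ^ n - c *\<^sub>C 1)"
proof (induction n arbitrary: c)
  case 0
  then show ?case using min by simp
next
  case (Suc n)
  let ?s = "csqrt c"
  have "?s * ?s = c" by (metis power2_csqrt power2_eq_square)
  then have "c *\<^sub>C (1::'a) = (?s *\<^sub>C 1) * (?s *\<^sub>C 1)"
    by (simp add: mult_scaleC_left scaleC_scaleC)
  then have "y ^ 2 ^ Suc n - c *\<^sub>C 1 = (y ^ 2 ^ n - ?s *\<^sub>C 1) * (y ^ 2 ^ n - (- ?s) *\<^sub>C 1)"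
    by (simp add: scaleC_uminus_left algebra_simps mult_2 power_add)
  moreover have "m ^ 2 ^ n * m ^ 2 ^ n \<le> q (y ^ 2 ^ n - ?s *\<^sub>C 1) * q (y ^ 2 ^ n - (- ?s) *\<^sub>C 1)"
    using \<open>0 \<le> m\<close> by (intro mult_mono Suc.IH order_trans[OF _ Suc.IH]) simp_all
  ultimately show ?case by (simp add: mult mult_2 power_add)
qed

(* Telescoping y^(2^n) - mu^(2^n) = (y - mu) (y + mu) (y^2 + mu^2) ... with every other factor of
   size at least the power of the minimum m. *)
lemma multiplicative_seminorm_power_two_power_diff_factor:
  fixes q :: "'a::involutive_algebra \<Rightarrow> real"
  assumes sn: "seminorm q" and mult: "\<And>x y. q (x * y) = q x * q y"
    and "0 \<le> m" and min: "\<And>c. m \<le> q (y - c *\<^sub>C 1)"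
  shows "q (y - \<mu> *\<^sub>C 1) * m ^ 2 ^ n \<le> m * q (y ^ 2 ^ n - (\<mu> ^ 2 ^ n) *\<^sub>C 1)"
proof (induction n)
  case (Suc n)
  let ?s = "\<mu> ^ 2 ^ n"
  have "y ^ 2 ^ Suc n - (\<mu> ^ 2 ^ Suc n) *\<^sub>C 1 = (y ^ 2 ^ n - ?s *\<^sub>C 1) * (y ^ 2 ^ n - (- ?s) *\<^sub>C 1)"
    by (simp add: scaleC_uminus_left algebra_simps mult_2 power_add mult_scaleC_left scaleC_scaleC)
  then have eq: "q (y ^ 2 ^ Suc n - (\<mu> ^ 2 ^ Suc n) *\<^sub>C 1) =
      q (y ^ 2 ^ n - ?s *\<^sub>C 1) * q (y ^ 2 ^ n - (- ?s) *\<^sub>C 1)"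
    by (simp only: mult)
  have pow: "m ^ 2 ^ Suc n = m ^ 2 ^ n * m ^ 2 ^ n" by (simp add: mult_2 power_add)
  show ?case
    unfolding eq pow mult.assoc[symmetric]
    using \<open>0 \<le> m\<close> seminorm_nonneg[OF sn]
    by (intro mult_mono[OF Suc.IH multiplicative_seminorm_power_two_power_diff_ge[OF mult \<open>0 \<le> m\<close> min]]) simp_all
qed (simp add: mult.commute)

text \<open>The distance \<open>?f\<close> from \<open>x\<close> to the scalars attains a minimum
  \<open>m\<close>. If \<open>m\<close> were positive, every minimizer would carry a disc of radius
  \<open>m\<close> of further minimizers, so minimizers would exist arbitrarily far out, where
  \<open>?f\<close> is large.\<close>

lemma multiplicative_seminorm_exists_scalar:
  fixes q :: "'a::involutive_algebra \<Rightarrow> real"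
  assumes sn: "seminorm q" and one: "q 1 = 1" and mult: "\<And>x y. q (x * y) = q x * q y"
  shows "\<exists>c. q (x - c *\<^sub>C 1) = 0"
proof -
  let ?f = "\<lambda>c. q (x - c *\<^sub>C 1)"
  have diff: "x - c *\<^sub>C 1 - (x - d *\<^sub>C 1) = (d - c) *\<^sub>C 1" for c d
    using scaleC_add_left[of "d - c" c 1] by (simp add: algebra_simps)
  have lip: "\<bar>?f c - ?f d\<bar> \<le> cmod (c - d)" for c d
    using seminorm_reverse_triangle[OF sn, of "x - c *\<^sub>C 1" "x - d *\<^sub>C 1"]
    by (simp add: diff seminorm_scaleC[OF sn] one norm_minus_commute)
  have cont: "continuous_on UNIV ?f"
    unfolding continuous_on_iff
    by (metis dist_norm lip order.strict_trans1 real_norm_def)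
  \<comment> \<open>The triangle inequality gives \<open>cmod c \<le> q x + ?f c\<close>, while
    \<open>?f 0\<close> is \<open>q x\<close>. So a minimum on the disc of radius
    \<open>2 * q x\<close> is global.\<close>
  have large: "?f 0 < ?f c" if "2 * q x < cmod c" for c
    using seminorm_triangle_diff[OF sn, of x "x - c *\<^sub>C 1"] that
    by (simp add: seminorm_scaleC[OF sn] one)
  obtain c0 where c0: "\<And>c. ?f c0 \<le> ?f c"
  proof -
    have "0 \<le> 2 * q x" using seminorm_nonneg[OF sn] by simp
    then obtain c0 where c0: "c0 \<in> cball 0 (2 * q x)" "\<And>c. c \<in> cball 0 (2 * q x) \<Longrightarrow> ?f c0 \<le> ?f c"
      using continuous_attains_inf[OF compact_cball _ continuous_on_subset[OF cont subset_UNIV], of 0 "2 * q x"]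
      by auto
    have "?f c0 \<le> ?f c" for c
    proof (cases "cmod c \<le> 2 * q x")
      case False
      then have "?f 0 < ?f c" using large by simp
      moreover have "?f c0 \<le> ?f 0" using c0(2)[of 0] \<open>0 \<le> 2 * q x\<close> by simp
      ultimately show ?thesis by linarith
    qed (use c0 in auto)
    then show ?thesis using that by blast
  qed
  define m where "m = ?f c0"
  have "m = 0"
  proof (rule ccontr)
    assume "m \<noteq> 0"
    then have m: "0 < m" using seminorm_nonneg[OF sn, of "x - c0 *\<^sub>C 1"] by (simp add: m_def)
    have step: "?f (c + \<mu>) = m" if c: "?f c = m" and \<mu>: "cmod \<mu> < m" for c \<mu>
    proof (rule antisym)
      show "m \<le> ?f (c + \<mu>)" using c0 by (simp add: m_def)
      let ?y = "x - c *\<^sub>C 1"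
      have shift: "?y - d *\<^sub>C 1 = x - (c + d) *\<^sub>C 1" for d by (simp add: scaleC_add_left algebra_simps)
      have pow: "q (z ^ n) = q z ^ n" for z n by (induction n) (simp_all add: one mult)
      \<comment> \<open>This is the factorization bound divided by \<open>m ^ 2 ^ n\<close>; the
        last term tends to 0 because \<open>cmod \<mu> < m\<close>.\<close>
      have "?f (c + \<mu>) \<le> m + m * (cmod \<mu> / m) ^ 2 ^ n" for n :: nat
      proof -
        have "?f (c + \<mu>) * m ^ 2 ^ n \<le> m * q (?y ^ 2 ^ n - (\<mu> ^ 2 ^ n) *\<^sub>C 1)"
          using multiplicative_seminorm_power_two_power_diff_factor[OF sn mult, of m ?y \<mu> n] m c0
          by (simp add: shift m_def)
        also have "\<dots> \<le> m * (m ^ 2 ^ n + cmod \<mu> ^ 2 ^ n)"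
          using seminorm_triangle_diff[OF sn, of "?y ^ 2 ^ n" "(\<mu> ^ 2 ^ n) *\<^sub>C 1"] m c
          by (simp add: pow seminorm_scaleC[OF sn] one norm_power)
        finally show ?thesis using m by (simp add: field_simps)
      qed
      moreover have "(\<lambda>n. m + m * (cmod \<mu> / m) ^ 2 ^ n) \<longlonglongrightarrow> m + m * 0"
        using m \<mu> LIMSEQ_subseq_LIMSEQ[OF LIMSEQ_power_zero[of "cmod \<mu> / m"], of "\<lambda>n. 2 ^ n"]
        by (intro tendsto_intros) (auto simp: o_def strict_mono_def)
      ultimately show "?f (c + \<mu>) \<le> m" by (intro LIMSEQ_le_const) auto
    qed
    \<comment> \<open>Steps of length \<open>m / 2\<close> are short enough for \<open>step\<close>,
      and enough of them leave the disc of radius \<open>2 * q x\<close>.\<close>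
    have all: "?f (c0 + of_nat n * of_real (m / 2)) = m" for n
    proof (induction n)
      case (Suc n)
      have "cmod (of_real (m/2)) < m" using m by (simp add: norm_divide)
      moreover have "c0 + of_nat (Suc n) * of_real (m / 2) = c0 + of_nat n * of_real (m / 2) + of_real (m / 2)"
        by (simp add: algebra_simps add_divide_distrib)
      ultimately show ?case using step[OF Suc.IH] by metis
    qed (simp add: m_def)
    obtain n :: nat where n: "2 * q x + cmod c0 < n * (m / 2)"
      using reals_Archimedean3[of "m / 2"] m by (metis half_gt_zero)
    have "cmod (of_nat n * of_real (m / 2)) = n * (m/2)" using m by (simp add: norm_mult norm_divide)
    then have "2 * q x < cmod (c0 + of_nat n * of_real (m / 2))"
      using n norm_triangle_ineq2[of "of_nat n * of_real (m / 2)" "- c0"] by (simp add: add.commute)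
    from large[OF this] show False using all c0[of 0] by (simp add: m_def)
  qed
  then show ?thesis by (auto simp: m_def)
qed

text \<open>The character sends \<open>x\<close> to the unique scalar with
  \<open>q (x - \<phi> x *\<^sub>C 1) = 0\<close>. Each algebraic law follows from uniqueness, as
  the null space of \<open>q\<close> is an ideal closed under \<open>star\<close>.\<close>

lemma multiplicative_Cstar_seminorm_eq_hermitian_character:
  fixes q :: "'a::involutive_algebra \<Rightarrow> real"
  assumes q: "Cstar_seminorm q" and one: "q 1 = 1" and mult: "\<And>x y. q (x * y) = q x * q y"
  obtains \<phi> where "\<phi> \<in> hermitian_characters" "\<And>x. q x = cmod (\<phi> x)"
proof -
  note sn = Cstar_seminorm_imp_seminorm[OF q]
  obtain \<phi> where \<phi>: "\<And>x. q (x - \<phi> x *\<^sub>C 1) = 0"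
    using multiplicative_seminorm_exists_scalar[OF sn one mult] by metis
  have uniq: "\<phi> x = c" if "q (x - c *\<^sub>C 1) = 0" for x c
  proof -
    have "x - \<phi> x *\<^sub>C 1 - (x - c *\<^sub>C 1) = (c - \<phi> x) *\<^sub>C 1"
      using scaleC_add_left[of "c - \<phi> x" "\<phi> x" 1] by (simp add: algebra_simps)
    then have "cmod (c - \<phi> x) \<le> 0"
      using seminorm_triangle_diff[OF sn, of "x - \<phi> x *\<^sub>C 1" "x - c *\<^sub>C 1"] that \<phi>[of x]
      by (simp add: seminorm_scaleC[OF sn] one)
    then show ?thesis by simp
  qed
  have null: "q z = 0" if "z = u + v" "q u = 0" "q v = 0" for u v z
    using seminorm_triangle[OF sn, of u v] seminorm_nonneg[OF sn, of z] that by simp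
  show thesis
  proof (rule that)
    show "q x = cmod (\<phi> x)" for x
      using seminorm_reverse_triangle[OF sn, of x "\<phi> x *\<^sub>C 1"] \<phi>[of x]
      by (simp add: seminorm_scaleC[OF sn] one)
    have "\<phi> (x + y) = \<phi> x + \<phi> y" for x y
      by (intro uniq null[OF _ \<phi>[of x] \<phi>[of y]]) (simp add: scaleC_add_left)
    moreover have "\<phi> (c *\<^sub>C x) = c * \<phi> x" for c x
    proof (rule uniq)
      have "c *\<^sub>C x - (c * \<phi> x) *\<^sub>C 1 = c *\<^sub>C (x - \<phi> x *\<^sub>C 1)"
        using scaleC_add_right[of c "x - \<phi> x *\<^sub>C 1" "\<phi> x *\<^sub>C 1"] by (simp add: scaleC_scaleC)
      then show "q (c *\<^sub>C x - (c * \<phi> x) *\<^sub>C 1) = 0" by (simp add: seminorm_scaleC[OF sn] \<phi>)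
    qed
    moreover have "\<phi> (x * y) = \<phi> x * \<phi> y" for x y
    proof (rule uniq, rule null)
      show "x * y - (\<phi> x * \<phi> y) *\<^sub>C 1 = (x - \<phi> x *\<^sub>C 1) * y + (\<phi> x *\<^sub>C 1) * (y - \<phi> y *\<^sub>C 1)"
        by (simp add: algebra_simps mult_scaleC_left scaleC_scaleC)
    qed (simp_all add: mult \<phi>)
    moreover have "\<phi> 1 = 1" by (rule uniq) (simp add: scaleC_one seminorm_zero[OF sn])
    moreover have "\<phi> (star x) = cnj (\<phi> x)" for x
      using Cstar_seminorm_star[OF q, of "x - \<phi> x *\<^sub>C 1"] \<phi>[of x]
      by (intro uniq) (simp add: star_diff star_scaleC)
    ultimately show "\<phi> \<in> hermitian_characters"
      by (simp add: hermitian_characters_def character_def)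
  qed
qed

text \<open>The multiplicative seminorm is built at the selfadjoint element
  \<open>a * star a\<close>; the C*-identity carries equality there back to
  \<open>a\<close>.\<close>

theorem Cstar_seminorm_attained_by_hermitian_character:
  fixes p :: "'a::involutive_algebra \<Rightarrow> real"
  assumes p: "Cstar_seminorm p" and nz: "p a \<noteq> 0"
  obtains \<phi> where "\<phi> \<in> hermitian_characters" "\<And>x. cmod (\<phi> x) \<le> p x" "cmod (\<phi> a) = p a"
proof -
  have "p (a * star a) \<noteq> 0" using nz by (simp add: Cstar_seminorm_mult_star[OF p])
  from exists_multiplicative_Cstar_seminorm[OF p this star_mult_star]
  obtain q where q: "Cstar_seminorm q" "q \<le> p" "q (a * star a) = p (a * star a)"
    "q 1 = 1" "\<And>x y. q (x * y) = q x * q y" by blast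
  obtain \<phi> where \<phi>: "\<phi> \<in> hermitian_characters" "\<And>x. q x = cmod (\<phi> x)"
    using multiplicative_Cstar_seminorm_eq_hermitian_character[OF q(1,4,5)] by blast
  have "q a = p a"
    using q(3) seminorm_nonneg[OF Cstar_seminorm_imp_seminorm[OF p]]
      seminorm_nonneg[OF Cstar_seminorm_imp_seminorm[OF q(1)]]
    by (simp add: Cstar_seminorm_mult_star[OF p] Cstar_seminorm_mult_star[OF q(1)] power2_eq_iff_nonneg)
  with \<phi> q(2) show thesis by (intro that[of \<phi>]) (auto simp: le_fun_def)
qed

subsection \<open>Compact sets of hermitian characters\<close>

definition dominated_characters ::
    "('a::involutive_algebra \<Rightarrow> real) \<Rightarrow> ('a \<Rightarrow> complex) set" where
  "dominated_characters p = {\<phi> \<in> hermitian_characters. \<forall>x. cmod (\<phi> x) \<le> p x}"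

lemma compactin_hermitian_character_space_iff:
  "compactin hermitian_character_space K \<longleftrightarrow> compact K \<and> K \<subseteq> hermitian_characters"
  by (simp add: hermitian_character_space_def euclidean_product_topology compactin_subtopology)

lemma character_diff:
  assumes "\<phi> \<in> hermitian_characters"
  shows "\<phi> (x - y) = \<phi> x - \<phi> y"
proof -
  have "\<phi> (x - y + y) = \<phi> (x - y) + \<phi> y"
    using assms unfolding hermitian_characters_def character_def by blast
  then show ?thesis by simp
qed

lemma hermitian_charactersD:
  assumes "\<phi> \<in> hermitian_characters"
  shows "\<phi> (x + y) = \<phi> x + \<phi> y" "\<phi> (c *\<^sub>C x) = c * \<phi> x" "\<phi> (x * y) = \<phi> x * \<phi> y"
    "\<phi> 1 = 1" "\<phi> (star x) = cnj (\<phi> x)" "\<phi> (x - y) = \<phi> x - \<phi> y"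
  using assms character_diff[OF assms] unfolding hermitian_characters_def character_def by auto

lemma continuous_on_eval: "continuous_on S (\<lambda>\<phi>::'b \<Rightarrow> complex. \<phi> x)"
  by (rule continuous_on_subset[OF continuous_on_product_coordinates]) simp

lemma closed_hermitian_characters:
  "closed (hermitian_characters :: ('a::involutive_algebra \<Rightarrow> complex) set)"
proof -
  have eq: "(hermitian_characters :: ('a \<Rightarrow> complex) set) =
      (\<Inter>x. \<Inter>y. {\<phi>. \<phi> (x + y) = \<phi> x + \<phi> y}) \<inter> (\<Inter>c. \<Inter>x. {\<phi>. \<phi> (c *\<^sub>C x) = c * \<phi> x}) \<inter>
      (\<Inter>x. \<Inter>y. {\<phi>. \<phi> (x * y) = \<phi> x * \<phi> y}) \<inter> {\<phi>. \<phi> 1 = 1} \<inter> (\<Inter>x. {\<phi>. \<phi> (star x) = cnj (\<phi> x)})"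
    by (auto simp: hermitian_characters_def character_def)
  show ?thesis
    unfolding eq by (intro closed_Int closed_INT ballI closed_Collect_eq
        continuous_on_eval continuous_on_add continuous_on_mult continuous_on_const continuous_on_cnj)
qed

text \<open>By Tychonoff the product of the discs of radius \<open>p x\<close> is compact, and the
  dominated characters form a closed part of it.\<close>

lemma compact_dominated_characters: "compact (dominated_characters p)"
proof -
  have "compactin (product_topology (\<lambda>_. euclidean) UNIV) (PiE UNIV (\<lambda>x. cball (0::complex) (p x)))"
    by (subst compactin_PiE) auto
  then have "compact (PiE UNIV (\<lambda>x. cball (0::complex) (p x)))"
    by (simp add: euclidean_product_topology)
  moreover have "dominated_characters p = hermitian_characters \<inter> PiE UNIV (\<lambda>x. cball 0 (p x))"
    by (auto simp: dominated_characters_def PiE_def Pi_def)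
  ultimately show ?thesis using closed_Int_compact[OF closed_hermitian_characters] by simp
qed

lemma Cstar_seminorm_cmod_character:
  assumes "\<phi> \<in> hermitian_characters"
  shows "Cstar_seminorm (\<lambda>x. cmod (\<phi> x))"
  using assms unfolding Cstar_seminorm_def seminorm_def
  by (simp add: hermitian_charactersD norm_mult norm_triangle_ineq power2_eq_square)

lemma bdd_above_cmod_eval:
  fixes K :: "('b \<Rightarrow> complex) set"
  assumes "compact K"
  shows "bdd_above ((\<lambda>\<phi>. cmod (\<phi> x)) ` K)"
proof -
  have "continuous_on K (\<lambda>\<phi>. cmod (\<phi> x))"
    by (intro continuous_on_norm continuous_on_eval)
  then show ?thesis using assms by (intro bounded_imp_bdd_above compact_imp_bounded compact_continuous_image)
qed

lemma cmod_le_sup_seminorm: "compact K \<Longrightarrow> \<phi> \<in> K \<Longrightarrow> cmod (\<phi> x) \<le> sup_seminorm K x"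
  by (auto simp: sup_seminorm_def intro!: cSUP_upper bdd_above_cmod_eval)

lemma sup_seminorm_le: "0 \<le> c \<Longrightarrow> (\<And>\<phi>. \<phi> \<in> K \<Longrightarrow> cmod (\<phi> x) \<le> c) \<Longrightarrow> sup_seminorm K x \<le> c"
  by (auto simp: sup_seminorm_def intro!: cSUP_least)

lemma sup_seminorm_nonneg:
  assumes "compact K"
  shows "0 \<le> sup_seminorm K x"
proof (cases "K = {}")
  case False
  then obtain \<phi> where "\<phi> \<in> K" by blast
  from order_trans[OF norm_ge_zero cmod_le_sup_seminorm[OF assms this]] show ?thesis .
qed (simp add: sup_seminorm_def)

lemma sup_seminorm_mono:
  "compact L \<Longrightarrow> K \<subseteq> L \<Longrightarrow> sup_seminorm K x \<le> sup_seminorm L x"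
  by (auto intro!: sup_seminorm_le sup_seminorm_nonneg cmod_le_sup_seminorm)

lemma Cstar_seminorm_sup_seminorm:
  assumes K: "compact K" "K \<subseteq> hermitian_characters"
  shows "Cstar_seminorm (sup_seminorm K)"
proof -
  note upper = cmod_le_sup_seminorm[OF K(1)]
  note nonneg = sup_seminorm_nonneg[OF K(1)]
  have hc: "\<phi> \<in> hermitian_characters" if "\<phi> \<in> K" for \<phi> using that K by auto
  have "seminorm (sup_seminorm K)"
    unfolding seminorm_def
  proof (intro conjI allI)
    show "sup_seminorm K (x + y) \<le> sup_seminorm K x + sup_seminorm K y" for x y
      using hc by (intro sup_seminorm_le add_nonneg_nonneg nonneg)
        (simp add: hermitian_charactersD norm_triangle_le add_mono upper)
    have le: "sup_seminorm K (c *\<^sub>C x) \<le> cmod c * sup_seminorm K x" for c x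
      using hc by (intro sup_seminorm_le mult_nonneg_nonneg nonneg)
        (simp_all add: hermitian_charactersD norm_mult mult_left_mono upper)
    show "sup_seminorm K (c *\<^sub>C x) = cmod c * sup_seminorm K x" for c x
    proof (cases "c = 0")
      case True
      then show ?thesis using le[of c x] nonneg[of "c *\<^sub>C x"] by simp
    next
      case False
      \<comment> \<open>The reverse inequality is \<open>le\<close> for the inverse scalar.\<close>
      then have "sup_seminorm K x \<le> cmod (inverse c) * sup_seminorm K (c *\<^sub>C x)"
        using le[of "inverse c" "c *\<^sub>C x"] by (simp add: scaleC_scaleC scaleC_one)
      then show ?thesis using le[of c x] False by (simp add: norm_divide field_simps)
    qed
  qed (rule nonneg)
  moreover have "sup_seminorm K (x * star x) = (sup_seminorm K x)\<^sup>2" for x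
  proof (rule antisym)
    have eq: "cmod (\<phi> (x * star x)) = (cmod (\<phi> x))\<^sup>2" if "\<phi> \<in> K" for \<phi>
      using hc[OF that] by (simp add: hermitian_charactersD norm_mult power2_eq_square)
    show "sup_seminorm K (x * star x) \<le> (sup_seminorm K x)\<^sup>2"
      by (intro sup_seminorm_le) (simp_all add: eq power_mono upper)
    have "cmod (\<phi> x) \<le> sqrt (sup_seminorm K (x * star x))" if "\<phi> \<in> K" for \<phi>
      using upper[OF that, of "x * star x"] by (simp add: eq[OF that] real_le_rsqrt)
    then have "sup_seminorm K x \<le> sqrt (sup_seminorm K (x * star x))"
      by (intro sup_seminorm_le) (simp_all add: nonneg)
    then show "(sup_seminorm K x)\<^sup>2 \<le> sup_seminorm K (x * star x)"
      using power_mono[OF _ nonneg, of x "sqrt (sup_seminorm K (x * star x))" 2] nonneg by simp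
  qed
  ultimately show ?thesis by (simp add: Cstar_seminorm_def)
qed

text \<open>Where \<open>p x\<close> is nonzero, some dominated character attains it; where it is 0,
  nonnegativity suffices.\<close>

lemma sup_seminorm_dominated_characters:
  assumes p: "Cstar_seminorm p"
  shows "sup_seminorm (dominated_characters p) = p"
proof (rule ext, rule antisym)
  fix x
  have p0: "0 \<le> p x" by (rule seminorm_nonneg[OF Cstar_seminorm_imp_seminorm[OF p]])
  show "sup_seminorm (dominated_characters p) x \<le> p x"
    by (rule sup_seminorm_le[OF p0]) (simp add: dominated_characters_def)
  show "p x \<le> sup_seminorm (dominated_characters p) x"
  proof (cases "p x = 0")
    case False
    obtain \<phi> where \<phi>: "\<phi> \<in> hermitian_characters" "\<And>y. cmod (\<phi> y) \<le> p y" "cmod (\<phi> x) = p x"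
      using Cstar_seminorm_attained_by_hermitian_character[OF p False] by blast
    then have "\<phi> \<in> dominated_characters p" by (simp add: dominated_characters_def)
    from cmod_le_sup_seminorm[OF compact_dominated_characters this, of x] \<phi>(3) show ?thesis by simp
  qed (simp add: sup_seminorm_nonneg compact_dominated_characters)
qed

(* If phi were outside K, a finite sum b of elements (a - phi a)(a - phi a)^* would satisfy phi b = 0
   and psi b >= delta > 0 on K, so M - b would contradict the domination for M large. *)
lemma dominated_by_sup_seminorm_imp_mem:
  fixes K :: "('a::involutive_algebra \<Rightarrow> complex) set"
  assumes K: "compact K" "K \<subseteq> hermitian_characters"
    and \<phi>: "\<phi> \<in> hermitian_characters" and le: "\<And>x. cmod (\<phi> x) \<le> sup_seminorm K x"
  shows "\<phi> \<in> K"
proof (rule ccontr)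
  assume notin: "\<phi> \<notin> K"
  have hc: "\<psi> \<in> hermitian_characters" if "\<psi> \<in> K" for \<psi> using that K by auto
  define b where "b a = (a - \<phi> a *\<^sub>C 1) * star (a - \<phi> a *\<^sub>C 1)" for a
  have b: "\<psi> (b a) = of_real ((cmod (\<psi> a - \<phi> a))\<^sup>2)" if "\<psi> \<in> hermitian_characters" for \<psi> a
    using that by (simp add: b_def hermitian_charactersD complex_norm_square del: complex_cnj_diff of_real_power)
  define U where "U a = {\<psi>. \<psi> a \<noteq> \<phi> a}" for a
  have "open (U a)" for a
    unfolding U_def by (intro open_Collect_neq continuous_on_eval continuous_on_const)
  moreover have "K \<subseteq> (\<Union>a\<in>UNIV. U a)" using notin by (auto simp: U_def fun_eq_iff) (metis ext)
  ultimately obtain F where F: "finite F" "K \<subseteq> (\<Union>a\<in>F. U a)"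
    using compactE_image[OF K(1), of UNIV U] by (metis subset_UNIV)
  define B where "B = sum b F"
  have sum: "\<psi> (sum b F) = (\<Sum>a\<in>F. \<psi> (b a))" if "\<psi> \<in> hermitian_characters" for \<psi>
    using F(1) by (induction F rule: finite_induct)
      (use hermitian_charactersD(2)[OF that, of 0 0] in \<open>simp_all add: hermitian_charactersD[OF that]\<close>)
  define g where "g \<psi> = (\<Sum>a\<in>F. (cmod (\<psi> a - \<phi> a))\<^sup>2)" for \<psi> :: "'a \<Rightarrow> complex"
  have g: "\<psi> B = of_real (g \<psi>)" if "\<psi> \<in> hermitian_characters" for \<psi>
    by (simp add: B_def sum[OF that] b[OF that] g_def)
  have "\<phi> B = 0" using g[OF \<phi>] by (simp add: g_def)
  \<comment> \<open>The supremum seminorm of the empty set is 0, but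
    \<open>\<phi> 1 = 1\<close>.\<close>
  have "K \<noteq> {}" using le[of 1] \<phi> by (auto simp: sup_seminorm_def hermitian_charactersD)
  have contg: "continuous_on K g"
    unfolding g_def
    by (intro continuous_on_sum continuous_on_power continuous_on_norm continuous_on_diff
        continuous_on_eval continuous_on_const)
  obtain \<psi>0 where "\<psi>0 \<in> K" and min: "\<And>\<psi>. \<psi> \<in> K \<Longrightarrow> g \<psi>0 \<le> g \<psi>"
    using continuous_attains_inf[OF K(1) \<open>K \<noteq> {}\<close> contg] by blast
  obtain \<psi>1 where "\<psi>1 \<in> K" and max: "\<And>\<psi>. \<psi> \<in> K \<Longrightarrow> g \<psi> \<le> g \<psi>1"
    using continuous_attains_sup[OF K(1) \<open>K \<noteq> {}\<close> contg] by blast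
  obtain a where "a \<in> F" "\<psi>0 a \<noteq> \<phi> a" using F(2) \<open>\<psi>0 \<in> K\<close> by (auto simp: U_def)
  then have pos: "0 < g \<psi>0" unfolding g_def by (intro sum_pos2[OF F(1)]) auto
  \<comment> \<open>With the maximum of \<open>g\<close> on \<open>K\<close> as constant, the values
    of \<open>?c\<close> on \<open>K\<close> lie between 0 and \<open>?M - g \<psi>0\<close>, while
    \<open>\<phi>\<close> takes the value \<open>?M\<close>.\<close>
  let ?M = "g \<psi>1"
  let ?c = "of_real ?M *\<^sub>C 1 - B"
  have "sup_seminorm K ?c \<le> ?M - g \<psi>0"
  proof (rule sup_seminorm_le)
    show "0 \<le> ?M - g \<psi>0" using max[OF \<open>\<psi>0 \<in> K\<close>] by simp
    fix \<psi> assume "\<psi> \<in> K"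
    then have "\<psi> ?c = of_real (?M - g \<psi>)"
      using hc g by (simp add: hermitian_charactersD)
    then show "cmod (\<psi> ?c) \<le> ?M - g \<psi>0"
      using max[OF \<open>\<psi> \<in> K\<close>] min[OF \<open>\<psi> \<in> K\<close>] by (simp only: norm_of_real)
  qed
  moreover have "cmod (\<phi> ?c) = ?M"
    using pos max[OF \<open>\<psi>0 \<in> K\<close>] by (simp add: hermitian_charactersD[OF \<phi>] \<open>\<phi> B = 0\<close>)
  ultimately show False using le[of ?c] pos by simp
qed

text \<open>The case of a one-point \<open>K\<close>: moduli of distinct hermitian characters are
  incomparable, which will make them minimal seminorms.\<close>

lemma dominated_by_character_imp_eq:
  assumes "\<phi> \<in> hermitian_characters" "\<psi> \<in> hermitian_characters" "\<And>x. cmod (\<phi> x) \<le> cmod (\<psi> x)"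
  shows "\<phi> = \<psi>"
  using dominated_by_sup_seminorm_imp_mem[of "{\<psi>}" \<phi>] assms by (simp add: sup_seminorm_def)

subsection \<open>Topologies defined by seminorms\<close>

lemma topspace_seminorms_topology [simp]: "topspace (seminorms_topology P) = UNIV"
  by (auto simp: seminorms_topology_def)

lemma openin_seminorms_topology_ball:
  "p \<in> P \<Longrightarrow> 0 < e \<Longrightarrow> openin (seminorms_topology P) {y. p (y - x) < e}"
  unfolding seminorms_topology_def by (intro topology_generated_by_Basis) auto

lemma openin_seminorms_topology_Int_balls:
  assumes "finite F" "F \<subseteq> P" "0 < e"
  shows "openin (seminorms_topology P) {y. \<forall>p\<in>F. p (y - x) < e}"
  using assms
proof (induction F rule: finite_induct)
  case empty
  then show ?case using openin_topspace[of "seminorms_topology P"] by simp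
next
  case (insert p F)
  have "{y. \<forall>p\<in>insert p F. p (y - x) < e} = {y. p (y - x) < e} \<inter> {y. \<forall>p\<in>F. p (y - x) < e}" by auto
  then show ?case using insert by (auto intro!: openin_Int openin_seminorms_topology_ball)
qed

text \<open>The generating balls have arbitrary centres. By the triangle inequality a ball about
  \<open>z\<close> that contains \<open>x\<close> contains a ball about \<open>x\<close>, of radius
  \<open>e - p (x - z)\<close>.\<close>

lemma openin_seminorms_topology_nhd:
  assumes P: "\<And>p. p \<in> P \<Longrightarrow> seminorm p" and "openin (seminorms_topology P) U" "x \<in> U"
  obtains F e where "finite F" "F \<subseteq> P" "0 < e" "{y. \<forall>p\<in>F. p (y - x) < e} \<subseteq> U"
proof -
  have "\<forall>x\<in>U. \<exists>F e. finite F \<and> F \<subseteq> P \<and> 0 < e \<and> {y. \<forall>p\<in>F. p (y - x) < e} \<subseteq> U"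
    using assms(2) unfolding seminorms_topology_def openin_topology_generated_by_iff
  proof (induction rule: generate_topology_on.induct)
    case (Int a b)
    show ?case
    proof
      fix x assume "x \<in> a \<inter> b"
      then have x: "x \<in> a" "x \<in> b" by auto
      obtain F e where F: "finite F" "F \<subseteq> P" "0 < e" "{y. \<forall>p\<in>F. p (y - x) < e} \<subseteq> a"
        using bspec[OF Int.IH(1) x(1)] by blast
      obtain G d where G: "finite G" "G \<subseteq> P" "0 < d" "{y. \<forall>p\<in>G. p (y - x) < d} \<subseteq> b"
        using bspec[OF Int.IH(2) x(2)] by blast
      have "{y. \<forall>p\<in>F \<union> G. p (y - x) < min e d} \<subseteq> a \<inter> b" using F(4) G(4) by auto
      moreover have "finite (F \<union> G)" "F \<union> G \<subseteq> P" "0 < min e d" using F(1-3) G(1-3) by auto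
      ultimately show "\<exists>F e. finite F \<and> F \<subseteq> P \<and> 0 < e \<and> {y. \<forall>p\<in>F. p (y - x) < e} \<subseteq> a \<inter> b"
        by (intro exI[of _ "F \<union> G"] exI[of _ "min e d"] conjI)
    qed
  next
    case (UN K)
    show ?case
    proof
      fix x assume "x \<in> \<Union>K"
      then obtain k where k: "k \<in> K" "x \<in> k" by blast
      then obtain F e where *: "finite F" "F \<subseteq> P" "0 < e" "{y. \<forall>p\<in>F. p (y - x) < e} \<subseteq> k"
        using bspec[OF UN.IH[OF k(1)] k(2)] by blast
      have "{y. \<forall>p\<in>F. p (y - x) < e} \<subseteq> \<Union>K" using *(4) Union_upper[OF k(1)] by (rule subset_trans)
      with * show "\<exists>F e. finite F \<and> F \<subseteq> P \<and> 0 < e \<and> {y. \<forall>p\<in>F. p (y - x) < e} \<subseteq> \<Union>K"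
        by (intro exI[of _ F] exI[of _ e] conjI)
    qed
  next
    case (Basis s)
    show ?case
    proof
      fix x assume x: "x \<in> s"
      have "s = UNIV \<or> (\<exists>p z e. s = {y. p (y - z) < e} \<and> p \<in> P \<and> 0 < e)" using Basis by simp
      then consider "s = UNIV" | p z e where "s = {y. p (y - z) < e}" "p \<in> P" "0 < e" by blast
      then show "\<exists>F e. finite F \<and> F \<subseteq> P \<and> 0 < e \<and> {y. \<forall>p\<in>F. p (y - x) < e} \<subseteq> s"
      proof cases
        case 1
        then show ?thesis by (intro exI[of _ "{}"] exI[of _ 1]) auto
      next
        case 2
        have "p (y - z) < e" if "p (y - x) < e - p (x - z)" for y
          using seminorm_ball_triangle[OF P[OF 2(2)], of y z x] that by simp
        then have "{y. \<forall>q\<in>{p}. q (y - x) < e - p (x - z)} \<subseteq> s" by (simp add: 2(1) Collect_mono)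
        moreover have "0 < e - p (x - z)" using x 2(1) by simp
        moreover have "finite {p}" "{p} \<subseteq> P" using 2(2) by simp_all
        ultimately show ?thesis by (intro exI[of _ "{p}"] exI[of _ "e - p (x - z)"] conjI)
      qed
    qed
  qed simp
  from bspec[OF this assms(3)] show thesis by (elim exE conjE that)
qed

text \<open>This says that \<open>q\<close> is at most the maximum of a finite set \<open>F\<close> of
  seminorms in \<open>P\<close>; the bound \<open>c\<close> stands for that maximum, which is 0 if \<open>F\<close> is empty.\<close>

definition finitely_dominated ::
    "('a::involutive_algebra \<Rightarrow> real) set \<Rightarrow> ('a \<Rightarrow> real) \<Rightarrow> bool" where
  "finitely_dominated P q \<longleftrightarrow>
     (\<exists>F. finite F \<and> F \<subseteq> P \<and> (\<forall>x c. 0 \<le> c \<and> (\<forall>p\<in>F. p x \<le> c) \<longrightarrow> q x \<le> c))"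

lemma finitely_dominated_mem: "p \<in> P \<Longrightarrow> finitely_dominated P p"
  unfolding finitely_dominated_def by (intro exI[of _ "{p}"]) auto

lemma finitely_dominated_le:
  "finitely_dominated P p \<Longrightarrow> (\<And>x. q x \<le> p x) \<Longrightarrow> finitely_dominated P q"
  unfolding finitely_dominated_def by (meson order_trans)

lemma openin_ball_finitely_dominated:
  assumes P: "\<And>p. p \<in> P \<Longrightarrow> seminorm p" and q: "seminorm q" "finitely_dominated P q"
  shows "openin (seminorms_topology P) {y. q (y - x) < e}"
proof (subst openin_subopen, rule ballI)
  fix z assume "z \<in> {y. q (y - x) < e}"
  \<comment> \<open>Half of the remaining radius, since finite domination yields only a non-strict
    bound.\<close>
  then have pos: "0 < (e - q (z - x)) / 2" by simp
  obtain F where F: "finite F" "F \<subseteq> P" "\<And>x c. 0 \<le> c \<Longrightarrow> (\<forall>p\<in>F. p x \<le> c) \<Longrightarrow> q x \<le> c"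
    using q(2) unfolding finitely_dominated_def by blast
  let ?T = "{y. \<forall>p\<in>F. p (y - z) < (e - q (z - x)) / 2}"
  have "?T \<subseteq> {y. q (y - x) < e}"
  proof safe
    fix y assume "\<forall>p\<in>F. p (y - z) < (e - q (z - x)) / 2"
    then have "q (y - z) \<le> (e - q (z - x)) / 2" using pos by (intro F(3)) (auto intro: less_imp_le)
    then show "q (y - x) < e"
      using seminorm_ball_triangle[OF q(1), of y x z] pos by simp
  qed
  moreover have "z \<in> ?T"
    using F(2) P pos by (auto simp: seminorm_zero)
  ultimately show "\<exists>T. openin (seminorms_topology P) T \<and> z \<in> T \<and> T \<subseteq> {y. q (y - x) < e}"
    using openin_seminorms_topology_Int_balls[OF F(1,2) pos] by blast
qed

lemma weaker_seminorms_topology: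
  assumes P: "\<And>p. p \<in> P \<Longrightarrow> seminorm p" and Q: "\<And>q. q \<in> Q \<Longrightarrow> seminorm q \<and> finitely_dominated P q"
  shows "weaker_topology (seminorms_topology Q) (seminorms_topology P)"
  unfolding weaker_topology_def
proof (intro allI impI)
  fix U assume "openin (seminorms_topology Q) U"
  then have "generate_topology_on (insert UNIV {{y. p (y - x) < e} |p x e. p \<in> Q \<and> 0 < e}) U"
    unfolding seminorms_topology_def openin_topology_generated_by_iff .
  then show "openin (seminorms_topology P) U"
  proof (rule generate_topology_on_coarsest[OF istopology_openin, rotated])
    fix s assume "s \<in> insert UNIV {{y. p (y - x) < e} |p x e. p \<in> Q \<and> 0 < e}"
    then consider "s = UNIV" | q x e where "q \<in> Q" "s = {y. q (y - x) < e}" by auto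
    then show "openin (seminorms_topology P) s"
    proof cases
      case 1
      then show ?thesis using openin_topspace[of "seminorms_topology P"] by simp
    next
      case 2
      then show ?thesis using openin_ball_finitely_dominated[OF P] Q by simp
    qed
  qed
qed

text \<open>A map that is Lipschitz for \<open>q\<close> pulls balls back to neighbourhoods. This
  serves both seminorms, by the reverse triangle inequality, and characters.\<close>

lemma continuous_map_finitely_dominated:
  fixes f :: "'a::involutive_algebra \<Rightarrow> 'b::metric_space"
  assumes P: "\<And>p. p \<in> P \<Longrightarrow> seminorm p" and q: "seminorm q" "finitely_dominated P q"
    and lip: "\<And>x y. dist (f x) (f y) \<le> q (x - y)"
  shows "continuous_map (seminorms_topology P) euclidean f"
  unfolding continuous_map_def
proof (intro conjI allI impI)
  fix U :: "'b set" assume "openin euclidean U"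
  then have "open U" by simp
  show "openin (seminorms_topology P) {x \<in> topspace (seminorms_topology P). f x \<in> U}"
  proof (subst openin_subopen, rule ballI)
    fix x assume "x \<in> {x \<in> topspace (seminorms_topology P). f x \<in> U}"
    then obtain e where e: "0 < e" "ball (f x) e \<subseteq> U" using openE[OF \<open>open U\<close>] by auto
    have "{y. q (y - x) < e} \<subseteq> {x. f x \<in> U}"
      using e(2) order.strict_trans1[OF lip] by (auto simp: subset_iff dist_commute)
    then show "\<exists>T. openin (seminorms_topology P) T \<and> x \<in> T \<and>
        T \<subseteq> {x \<in> topspace (seminorms_topology P). f x \<in> U}"
      using openin_ball_finitely_dominated[OF P q, of x e] e(1)
      by (intro exI[of _ "{y. q (y - x) < e}"]) (simp add: seminorm_zero[OF q(1)])
  qed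
qed auto

section \<open>Continuity of C*-seminorms and of hermitian characters\<close>

text \<open>The maximum of finitely many C*-seminorms is the supremum over the union of their
  compact sets of characters, hence again a C*-seminorm. For empty \<open>F\<close> it is 0.\<close>

lemma sup_seminorm_UN_dominated_characters:
  assumes F: "finite F" "\<And>p. p \<in> F \<Longrightarrow> Cstar_seminorm p"
  shows "Cstar_seminorm (sup_seminorm (\<Union>(dominated_characters ` F)))"
    and "\<And>p x. p \<in> F \<Longrightarrow> p x \<le> sup_seminorm (\<Union>(dominated_characters ` F)) x"
    and "\<And>x c. 0 \<le> c \<Longrightarrow> (\<forall>p\<in>F. p x \<le> c) \<Longrightarrow> sup_seminorm (\<Union>(dominated_characters ` F)) x \<le> c"
proof -
  let ?K = "\<Union>(dominated_characters ` F)"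
  have K: "compact ?K" using F(1) by (intro compact_UN) (auto simp: compact_dominated_characters)
  show "Cstar_seminorm (sup_seminorm ?K)"
    by (intro Cstar_seminorm_sup_seminorm K) (auto simp: dominated_characters_def)
  show "p x \<le> sup_seminorm ?K x" if "p \<in> F" for p x
    using sup_seminorm_mono[OF K, of "dominated_characters p" x] that F(2)
    by (auto simp: sup_seminorm_dominated_characters)
  show "sup_seminorm ?K x \<le> c" if "0 \<le> c" "\<forall>p\<in>F. p x \<le> c" for x c
    using that by (intro sup_seminorm_le) (auto simp: dominated_characters_def intro: order_trans)
qed

text \<open>Continuity at 0 bounds \<open>q\<close> by a multiple of a finite maximum
  \<open>m\<close>. Both are C*-seminorms, so the multiple can be taken to be 1.\<close>

lemma continuous_Cstar_seminorm_iff_finitely_dominated: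
  assumes P: "\<And>p. p \<in> P \<Longrightarrow> Cstar_seminorm p" and q: "Cstar_seminorm q"
  shows "continuous_map (seminorms_topology P) euclideanreal q \<longleftrightarrow> finitely_dominated P q"
proof
  note snP = Cstar_seminorm_imp_seminorm[OF P]
  note snq = Cstar_seminorm_imp_seminorm[OF q]
  show "continuous_map (seminorms_topology P) euclideanreal q" if "finitely_dominated P q"
    using seminorm_reverse_triangle[OF snq]
    by (intro continuous_map_finitely_dominated[OF snP snq that]) (auto simp: dist_real_def)
  assume cont: "continuous_map (seminorms_topology P) euclideanreal q"
  have "openin (seminorms_topology P) {x \<in> topspace (seminorms_topology P). q x \<in> {..<1}}"
    by (rule openin_continuous_map_preimage[OF cont]) simp
  then have "openin (seminorms_topology P) {x. q x < 1}" by simp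
  then obtain F e where F: "finite F" "F \<subseteq> P" "0 < e" "{y. \<forall>p\<in>F. p (y - 0) < e} \<subseteq> {x. q x < 1}"
    by (rule openin_seminorms_topology_nhd[OF snP, of P _ 0, rotated 1]) (simp_all add: seminorm_zero[OF snq])
  define m where "m = sup_seminorm (\<Union>(dominated_characters ` F))"
  have PF: "\<And>p. p \<in> F \<Longrightarrow> Cstar_seminorm p" using F(2) P by auto
  have Cstar_m: "Cstar_seminorm m"
    and le_m: "\<And>p x. p \<in> F \<Longrightarrow> p x \<le> m x"
    and m_le: "\<And>x c. 0 \<le> c \<Longrightarrow> \<forall>p\<in>F. p x \<le> c \<Longrightarrow> m x \<le> c"
    using sup_seminorm_UN_dominated_characters[OF F(1) PF] by (simp_all add: m_def)
  note snm = Cstar_seminorm_imp_seminorm[OF Cstar_m]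
  have "q x \<le> (1 / e) * m x" for x
  proof (rule field_le_epsilon)
    fix d :: real assume "0 < d"
    \<comment> \<open>The summand \<open>d\<close> keeps \<open>s\<close> positive when
      \<open>m x = 0\<close> and puts \<open>x\<close> divided by \<open>s\<close> strictly inside
      the neighbourhood of 0.\<close>
    define s where "s = m x / e + d"
    have s: "0 < s" using \<open>0 < d\<close> F(3) seminorm_nonneg[OF snm, of x] by (simp add: s_def add_nonneg_pos)
    have ms: "m x < e * s" using F(3) \<open>0 < d\<close> by (simp add: s_def field_simps)
    have "p (of_real (1 / s) *\<^sub>C x) < e" if "p \<in> F" for p
      using le_m[OF that, of x] ms s
      by (simp add: seminorm_scaleC[OF Cstar_seminorm_imp_seminorm[OF PF[OF that]]] norm_divide field_simps)
    then have "q (of_real (1 / s) *\<^sub>C x) < 1" using F(4) by auto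
    then have "q x < s" using s by (simp add: seminorm_scaleC[OF snq] norm_divide)
    then show "q x \<le> 1 / e * m x + d" by (simp add: s_def)
  qed
  then have "q x \<le> m x" for x by (rule Cstar_seminorm_le_of_le_scaled[OF Cstar_m q])
  then have "q x \<le> c" if "0 \<le> c" "\<forall>p\<in>F. p x \<le> c" for x c
    using m_le[OF that] by (rule order_trans)
  then show "finitely_dominated P q"
    unfolding finitely_dominated_def using F(1,2) by (intro exI[of _ F]) simp
qed

lemma continuous_character_iff_finitely_dominated:
  assumes P: "\<And>p. p \<in> P \<Longrightarrow> Cstar_seminorm p" and \<phi>: "\<phi> \<in> hermitian_characters"
  shows "continuous_map (seminorms_topology P) euclidean \<phi> \<longleftrightarrow> finitely_dominated P (\<lambda>x. cmod (\<phi> x))"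
proof
  note Cstar = Cstar_seminorm_cmod_character[OF \<phi>]
  show "finitely_dominated P (\<lambda>x. cmod (\<phi> x))" if "continuous_map (seminorms_topology P) euclidean \<phi>"
    using continuous_map_norm[OF that]
    by (simp add: continuous_Cstar_seminorm_iff_finitely_dominated[OF P Cstar])
  show "continuous_map (seminorms_topology P) euclidean \<phi>" if "finitely_dominated P (\<lambda>x. cmod (\<phi> x))"
    by (rule continuous_map_finitely_dominated[OF _ _ that])
      (auto simp: dist_norm hermitian_charactersD[OF \<phi>] intro: Cstar_seminorm_imp_seminorm P Cstar)
qed

text \<open>Finitely many sets of \<open>B\<close> may be replaced by their compact union, whose
  seminorm dominates each of theirs.\<close>

lemma finitely_dominated_sup_seminorm_image:
  assumes "finitely_dominated (sup_seminorm ` B) q"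
    and "\<And>K. K \<in> B \<Longrightarrow> compact K"
  obtains F where "finite F" "F \<subseteq> B" "compact (\<Union>F)" "\<And>x. q x \<le> sup_seminorm (\<Union>F) x"
proof -
  obtain G where G: "finite G" "G \<subseteq> sup_seminorm ` B" "\<And>x c. 0 \<le> c \<Longrightarrow> (\<forall>p\<in>G. p x \<le> c) \<Longrightarrow> q x \<le> c"
    using assms(1) unfolding finitely_dominated_def by blast
  obtain F where F: "F \<subseteq> B" "finite F" "G = sup_seminorm ` F"
    using finite_subset_image[OF G(1,2)] by blast
  have comp: "compact (\<Union>F)" using F assms(2) by (intro compact_Union) auto
  show thesis
  proof (rule that[OF F(2,1) comp])
    show "q x \<le> sup_seminorm (\<Union>F) x" for x
      using F(3) comp by (intro G(3) sup_seminorm_nonneg) (auto intro!: sup_seminorm_mono)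
  qed
qed

lemma finitely_dominated_sup_seminorm_finite:
  assumes "finite K" "\<And>\<phi>. \<phi> \<in> K \<Longrightarrow> finitely_dominated P (\<lambda>x. cmod (\<phi> x))"
  shows "finitely_dominated P (sup_seminorm K)"
proof -
  obtain F where F: "\<And>\<phi>. \<phi> \<in> K \<Longrightarrow> finite (F \<phi>) \<and> F \<phi> \<subseteq> P \<and>
      (\<forall>x c. 0 \<le> c \<and> (\<forall>p\<in>F \<phi>. p x \<le> c) \<longrightarrow> cmod (\<phi> x) \<le> c)"
    using assms(2) unfolding finitely_dominated_def by metis
  then show ?thesis
    unfolding finitely_dominated_def using assms(1)
    by (intro exI[of _ "\<Union>(F ` K)"]) (auto intro!: sup_seminorm_le)
qed

subsection \<open>Compatible topologies\<close>

text \<open>A character in some \<open>K\<close> is dominated by the seminorm of \<open>K\<close>.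
  Conversely, a continuous one is dominated by the seminorm of a finite union of members of
  \<open>B\<close>, so it belongs to that union and thus to \<Gamma>.\<close>

lemma uniform_convergence_topology_compatible:
  assumes B: "\<And>K. K \<in> B \<Longrightarrow> compactin hermitian_character_space K \<and> K \<subseteq> \<Gamma>" and cover: "\<Gamma> \<subseteq> \<Union>B"
  shows "uniform_convergence_topology B \<in> compatible_LCstar_topologies \<Gamma>"
proof -
  have K: "compact K" "K \<subseteq> hermitian_characters" if "K \<in> B" for K
    using B[OF that] by (auto simp: compactin_hermitian_character_space_iff)
  have P: "\<And>p. p \<in> sup_seminorm ` B \<Longrightarrow> Cstar_seminorm p"
    using K Cstar_seminorm_sup_seminorm by blast
  have "continuous_hermitian_characters (uniform_convergence_topology B) = \<Gamma>"
  proof (intro set_eqI iffI)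
    fix \<phi> assume "\<phi> \<in> \<Gamma>"
    then obtain L where L: "L \<in> B" "\<phi> \<in> L" using cover by blast
    then have \<phi>: "\<phi> \<in> hermitian_characters" using K by blast
    have "finitely_dominated (sup_seminorm ` B) (\<lambda>x. cmod (\<phi> x))"
      using L(1) cmod_le_sup_seminorm[OF K(1)[OF L(1)] L(2)]
      by (intro finitely_dominated_le[OF finitely_dominated_mem[OF imageI]])
    then show "\<phi> \<in> continuous_hermitian_characters (uniform_convergence_topology B)"
      using continuous_character_iff_finitely_dominated[OF P \<phi>] \<phi>
      by (simp add: continuous_hermitian_characters_def uniform_convergence_topology_def)
  next
    fix \<phi> assume "\<phi> \<in> continuous_hermitian_characters (uniform_convergence_topology B)"
    then have \<phi>: "\<phi> \<in> hermitian_characters"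
      and "continuous_map (seminorms_topology (sup_seminorm ` B)) euclidean \<phi>"
      by (auto simp: continuous_hermitian_characters_def uniform_convergence_topology_def)
    then have "finitely_dominated (sup_seminorm ` B) (\<lambda>x. cmod (\<phi> x))"
      using continuous_character_iff_finitely_dominated[OF P \<phi>] by simp
    then obtain F where "finite F" and F: "F \<subseteq> B" "compact (\<Union>F)" "\<And>x. cmod (\<phi> x) \<le> sup_seminorm (\<Union>F) x"
      by (rule finitely_dominated_sup_seminorm_image) (use K(1) in auto)
    have "\<Union>F \<subseteq> hermitian_characters" using F(1) K(2) by (meson Sup_least subsetD)
    from dominated_by_sup_seminorm_imp_mem[OF F(2) this \<phi> F(3)] F(1) B show "\<phi> \<in> \<Gamma>" by blast
  qed
  then show ?thesis
    using P unfolding compatible_LCstar_topologies_def LCstar_topology_def uniform_convergence_topology_def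
    by blast
qed

lemma compatible_LCstar_topologyE:
  assumes "t \<in> compatible_LCstar_topologies \<Gamma>"
  obtains P where "\<And>p. p \<in> P \<Longrightarrow> Cstar_seminorm p" "t = seminorms_topology P"
    "\<And>\<phi>. \<phi> \<in> \<Gamma> \<longleftrightarrow> \<phi> \<in> hermitian_characters \<and> finitely_dominated P (\<lambda>x. cmod (\<phi> x))"
proof -
  obtain P where P: "\<And>p. p \<in> P \<Longrightarrow> Cstar_seminorm p" "t = seminorms_topology P"
    and \<Gamma>: "continuous_hermitian_characters t = \<Gamma>"
    using assms by (auto simp: compatible_LCstar_topologies_def LCstar_topology_def)
  show thesis
    using \<Gamma> continuous_character_iff_finitely_dominated[OF P(1)]
    by (intro that[OF P]) (auto simp: continuous_hermitian_characters_def P(2))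
qed

lemma compatible_LCstar_topology_eq_uniform_convergence:
  assumes "t \<in> compatible_LCstar_topologies \<Gamma>"
  obtains B where "\<And>K. K \<in> B \<Longrightarrow> compactin hermitian_character_space K \<and> K \<subseteq> \<Gamma>" "\<Gamma> \<subseteq> \<Union>B"
    "t = uniform_convergence_topology B"
proof -
  obtain P where P: "\<And>p. p \<in> P \<Longrightarrow> Cstar_seminorm p" "t = seminorms_topology P"
    and \<Gamma>: "\<And>\<phi>. \<phi> \<in> \<Gamma> \<longleftrightarrow> \<phi> \<in> hermitian_characters \<and> finitely_dominated P (\<lambda>x. cmod (\<phi> x))"
    using compatible_LCstar_topologyE[OF assms] by blast
  \<comment> \<open>The supremum seminorms of these sets are exactly the defining seminorms in
    \<open>P\<close>.\<close>
  let ?B = "dominated_characters ` P"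
  have "(\<lambda>p. sup_seminorm (dominated_characters p)) ` P = P"
    using P(1) by (simp add: sup_seminorm_dominated_characters)
  then have im: "sup_seminorm ` ?B = P" by (simp add: image_image)
  have dom: "dominated_characters p \<subseteq> \<Gamma>" if "p \<in> P" for p
    using finitely_dominated_le[OF finitely_dominated_mem[OF that]]
    by (auto simp: \<Gamma> dominated_characters_def)
  show thesis
  proof (rule that)
    show "compactin hermitian_character_space K \<and> K \<subseteq> \<Gamma>" if "K \<in> ?B" for K
    proof -
      obtain p where p: "p \<in> P" "K = dominated_characters p" using \<open>K \<in> ?B\<close> by blast
      then have "K \<subseteq> hermitian_characters" by (simp add: dominated_characters_def)
      then show ?thesis
        using dom[OF p(1)] by (simp add: compactin_hermitian_character_space_iff compact_dominated_characters p(2))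
    qed
    \<comment> \<open>A character of \<Gamma> is dominated by the seminorm of a finite union from
      \<open>?B\<close>, hence is a member of that union.\<close>
    show "\<Gamma> \<subseteq> \<Union>?B"
    proof
      fix \<phi> assume "\<phi> \<in> \<Gamma>"
      then have \<phi>: "\<phi> \<in> hermitian_characters" "finitely_dominated (sup_seminorm ` ?B) (\<lambda>x. cmod (\<phi> x))"
        by (auto simp: \<Gamma> im)
      obtain F where F: "F \<subseteq> ?B" "compact (\<Union>F)" "\<And>x. cmod (\<phi> x) \<le> sup_seminorm (\<Union>F) x"
        by (rule finitely_dominated_sup_seminorm_image[OF \<phi>(2)]) (use compact_dominated_characters in auto)
      have "\<Union>F \<subseteq> hermitian_characters" using F(1) by (auto simp: dominated_characters_def)
      from dominated_by_sup_seminorm_imp_mem[OF F(2) this \<phi>(1) F(3)] F(1) show "\<phi> \<in> \<Union>?B" by blast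
    qed
    show "t = uniform_convergence_topology ?B" by (simp add: uniform_convergence_topology_def im P(2))
  qed
qed

text \<open>Compatibility makes the modulus of each element of \<Gamma> finitely dominated, and this
  extends to suprema over finite sets.\<close>

lemma weakest_compatible_LCstar_topology:
  assumes "\<Gamma> \<subseteq> hermitian_characters"
  shows "weakest_topology_in (compatible_LCstar_topologies \<Gamma>)
    (uniform_convergence_topology {K. finite K \<and> K \<subseteq> \<Gamma>})"
  unfolding weakest_topology_in_def
proof (intro conjI ballI)
  show "uniform_convergence_topology {K. finite K \<and> K \<subseteq> \<Gamma>} \<in> compatible_LCstar_topologies \<Gamma>"
  proof (rule uniform_convergence_topology_compatible)
    show "\<Gamma> \<subseteq> \<Union>{K. finite K \<and> K \<subseteq> \<Gamma>}" by (auto intro: exI[of _ "{_}"])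
  qed (use assms in \<open>auto simp: compactin_hermitian_character_space_iff finite_imp_compact\<close>)
  fix t assume "t \<in> compatible_LCstar_topologies \<Gamma>"
  then obtain P where P: "\<And>p. p \<in> P \<Longrightarrow> Cstar_seminorm p" "t = seminorms_topology P"
    and \<Gamma>: "\<And>\<phi>. \<phi> \<in> \<Gamma> \<longleftrightarrow> \<phi> \<in> hermitian_characters \<and> finitely_dominated P (\<lambda>x. cmod (\<phi> x))"
    using compatible_LCstar_topologyE by blast
  show "weaker_topology (uniform_convergence_topology {K. finite K \<and> K \<subseteq> \<Gamma>}) t"
    unfolding uniform_convergence_topology_def P(2)
  proof (rule weaker_seminorms_topology)
    fix q assume "q \<in> sup_seminorm ` {K. finite K \<and> K \<subseteq> \<Gamma>}"
    then obtain K where K: "finite K" "K \<subseteq> \<Gamma>" "q = sup_seminorm K" by blast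
    then show "seminorm q \<and> finitely_dominated P q"
      using assms \<Gamma> by (auto intro!: Cstar_seminorm_imp_seminorm Cstar_seminorm_sup_seminorm
          finite_imp_compact finitely_dominated_sup_seminorm_finite)
  qed (use P in \<open>auto intro: Cstar_seminorm_imp_seminorm\<close>)
qed

text \<open>Every compatible topology comes from a subcollection of these compact sets, and the
  singletons among them cover \<Gamma>.\<close>

lemma strongest_compatible_LCstar_topology:
  assumes "\<Gamma> \<subseteq> hermitian_characters"
  shows "strongest_topology_in (compatible_LCstar_topologies \<Gamma>)
    (uniform_convergence_topology {K. compactin hermitian_character_space K \<and> K \<subseteq> \<Gamma>})"
  unfolding strongest_topology_in_def
proof (intro conjI ballI)
  let ?B = "{K. compactin hermitian_character_space K \<and> K \<subseteq> \<Gamma>}"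
  have sn: "seminorm q" if "q \<in> sup_seminorm ` ?B" for q
    using that by (auto simp: compactin_hermitian_character_space_iff
        intro!: Cstar_seminorm_imp_seminorm Cstar_seminorm_sup_seminorm)
  show "uniform_convergence_topology ?B \<in> compatible_LCstar_topologies \<Gamma>"
  proof (rule uniform_convergence_topology_compatible)
    show "\<Gamma> \<subseteq> \<Union>?B"
      using assms by (auto simp: compactin_hermitian_character_space_iff intro!: exI[of _ "{_}"])
  qed auto
  fix t assume "t \<in> compatible_LCstar_topologies \<Gamma>"
  then obtain B where B: "\<And>K. K \<in> B \<Longrightarrow> compactin hermitian_character_space K \<and> K \<subseteq> \<Gamma>"
    and t: "t = uniform_convergence_topology B"
    using compatible_LCstar_topology_eq_uniform_convergence by blast
  then have sub: "sup_seminorm ` B \<subseteq> sup_seminorm ` ?B" by blast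
  show "weaker_topology t (uniform_convergence_topology ?B)"
    unfolding t uniform_convergence_topology_def
  proof (rule weaker_seminorms_topology[OF sn])
    fix q assume "q \<in> sup_seminorm ` B"
    then have q: "q \<in> sup_seminorm ` ?B" by (rule subsetD[OF sub])
    show "seminorm q \<and> finitely_dominated (sup_seminorm ` ?B) q"
      using sn[OF q] finitely_dominated_mem[OF q] by (rule conjI)
  qed
qed

text \<open>In a Hausdorff topology some defining \<open>p\<close> is nonzero at
  \<open>y - x\<close>, and a dominated character attaining that value lies in \<Gamma>. Conversely,
  disjoint open sets are pulled back from the complex plane.\<close>

lemma Hausdorff_compatible_LCstar_topology_iff:
  assumes "t \<in> compatible_LCstar_topologies \<Gamma>"
  shows "Hausdorff_space t \<longleftrightarrow> (\<forall>x y. x \<noteq> y \<longrightarrow> (\<exists>\<phi>\<in>\<Gamma>. \<phi> x \<noteq> \<phi> y))"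
proof
  obtain P where P: "\<And>p. p \<in> P \<Longrightarrow> Cstar_seminorm p" "t = seminorms_topology P"
    and \<Gamma>: "\<And>\<phi>. \<phi> \<in> \<Gamma> \<longleftrightarrow> \<phi> \<in> hermitian_characters \<and> finitely_dominated P (\<lambda>x. cmod (\<phi> x))"
    using compatible_LCstar_topologyE[OF assms] by blast
  note snP = Cstar_seminorm_imp_seminorm[OF P(1)]
  show "\<forall>x y. x \<noteq> y \<longrightarrow> (\<exists>\<phi>\<in>\<Gamma>. \<phi> x \<noteq> \<phi> y)" if H: "Hausdorff_space t"
  proof (intro allI impI)
    fix x y :: 'a assume "x \<noteq> y"
    then obtain U where U: "openin (seminorms_topology P) U" "x \<in> U" "y \<notin> U"
      using H unfolding Hausdorff_space_def P(2) disjnt_iff topspace_seminorms_topology by (metis UNIV_I)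
    obtain F e where F: "F \<subseteq> P" "0 < e" "{z. \<forall>p\<in>F. p (z - x) < e} \<subseteq> U"
      by (rule openin_seminorms_topology_nhd[OF snP U(1,2)])
    have "y \<notin> {z. \<forall>p\<in>F. p (z - x) < e}" using F(3) U(3) by (rule contra_subsetD)
    then obtain p where "p \<in> F" "\<not> p (y - x) < e" by blast
    then have p: "p \<in> P" "p (y - x) \<noteq> 0" using F(1,2) by auto
    obtain \<phi> where \<phi>: "\<phi> \<in> hermitian_characters" "\<And>z. cmod (\<phi> z) \<le> p z" "cmod (\<phi> (y - x)) = p (y - x)"
      using Cstar_seminorm_attained_by_hermitian_character[OF P(1)[OF p(1)] p(2)] by blast
    have "\<phi> \<in> \<Gamma>"
      using \<phi> finitely_dominated_le[OF finitely_dominated_mem[OF p(1)]] by (simp add: \<Gamma>)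
    moreover have "\<phi> x \<noteq> \<phi> y" using \<phi>(3) p(2) by (auto simp: hermitian_charactersD[OF \<phi>(1)])
    ultimately show "\<exists>\<phi>\<in>\<Gamma>. \<phi> x \<noteq> \<phi> y" by blast
  qed
  assume sep: "\<forall>x y. x \<noteq> y \<longrightarrow> (\<exists>\<phi>\<in>\<Gamma>. \<phi> x \<noteq> \<phi> y)"
  show "Hausdorff_space t"
    unfolding Hausdorff_space_def
  proof (intro allI impI)
    fix x y assume "x \<in> topspace t \<and> y \<in> topspace t \<and> x \<noteq> y"
    then obtain \<phi> where "\<phi> \<in> \<Gamma>" and ne: "\<phi> x \<noteq> \<phi> y" and top: "x \<in> topspace t" "y \<in> topspace t"
      using sep by blast
    then have cont: "continuous_map t euclidean \<phi>"
      using continuous_character_iff_finitely_dominated[OF P(1)] \<Gamma> P(2) by blast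
    obtain U V where UV: "open U" "open V" "\<phi> x \<in> U" "\<phi> y \<in> V" "U \<inter> V = {}"
      using hausdorff[OF ne] by blast
    show "\<exists>U V. openin t U \<and> openin t V \<and> x \<in> U \<and> y \<in> V \<and> disjnt U V"
    proof (intro exI conjI)
      show "openin t {x \<in> topspace t. \<phi> x \<in> U}" "openin t {x \<in> topspace t. \<phi> x \<in> V}"
        using UV(1,2) by (auto intro: openin_continuous_map_preimage[OF cont])
      show "disjnt {x \<in> topspace t. \<phi> x \<in> U} {x \<in> topspace t. \<phi> x \<in> V}"
        using UV(5) by (auto simp: disjnt_iff)
    qed (use UV(3,4) top in simp_all)
  qed
qed

text \<open>The right-hand side mentions only \<Gamma>, so the minimal seminorms agree for all
  compatible topologies. Every nonzero C*-seminorm lies above the modulus of a hermitian character,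
  and such moduli are pairwise incomparable.\<close>

lemma minimal_continuous_Cstar_seminorm_iff:
  assumes "t \<in> compatible_LCstar_topologies \<Gamma>"
  shows "minimal_continuous_Cstar_seminorm t p \<longleftrightarrow> (\<exists>\<phi>\<in>\<Gamma>. p = (\<lambda>x. cmod (\<phi> x)))"
proof -
  obtain P where P: "\<And>p. p \<in> P \<Longrightarrow> Cstar_seminorm p" "t = seminorms_topology P"
    and \<Gamma>: "\<And>\<phi>. \<phi> \<in> \<Gamma> \<longleftrightarrow> \<phi> \<in> hermitian_characters \<and> finitely_dominated P (\<lambda>x. cmod (\<phi> x))"
    using compatible_LCstar_topologyE[OF assms] by blast
  have cont: "continuous_Cstar_seminorm t q \<longleftrightarrow> Cstar_seminorm q \<and> finitely_dominated P q" for q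
    using continuous_Cstar_seminorm_iff_finitely_dominated[OF P(1)]
    by (auto simp: continuous_Cstar_seminorm_def P(2))
  have nonzero: "(\<lambda>x. cmod (\<phi> x)) \<noteq> (\<lambda>_. 0)" if "\<phi> \<in> hermitian_characters" for \<phi>
    using hermitian_charactersD(4)[OF that] by (metis norm_one zero_neq_one)
  have below: "\<exists>\<phi>\<in>hermitian_characters. \<forall>x. cmod (\<phi> x) \<le> q x"
    if "Cstar_seminorm q" "q \<noteq> (\<lambda>_. 0)" for q
    using Cstar_seminorm_attained_by_hermitian_character[OF that(1)] that(2) by (metis ext)
  show ?thesis
  proof
    assume min: "minimal_continuous_Cstar_seminorm t p"
    then have p: "Cstar_seminorm p" "finitely_dominated P p" "p \<noteq> (\<lambda>_. 0)"
      by (auto simp: minimal_continuous_Cstar_seminorm_def cont)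
    then obtain \<phi> where \<phi>: "\<phi> \<in> hermitian_characters" "\<And>x. cmod (\<phi> x) \<le> p x" using below by blast
    have dom: "finitely_dominated P (\<lambda>x. cmod (\<phi> x))" by (rule finitely_dominated_le[OF p(2) \<phi>(2)])
    then have "(\<lambda>x. cmod (\<phi> x)) = p"
      using min \<phi> nonzero Cstar_seminorm_cmod_character
      unfolding minimal_continuous_Cstar_seminorm_def cont by blast
    then show "\<exists>\<phi>\<in>\<Gamma>. p = (\<lambda>x. cmod (\<phi> x))" using \<phi>(1) dom \<Gamma> by auto
  next
    assume "\<exists>\<phi>\<in>\<Gamma>. p = (\<lambda>x. cmod (\<phi> x))"
    then obtain \<phi> where \<phi>: "\<phi> \<in> hermitian_characters" "finitely_dominated P (\<lambda>x. cmod (\<phi> x))"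
      and p: "p = (\<lambda>x. cmod (\<phi> x))" using \<Gamma> by blast
    have "q = p" if q: "Cstar_seminorm q" "q \<noteq> (\<lambda>_. 0)" "\<forall>x. q x \<le> p x" for q
    proof -
      obtain \<psi> where \<psi>: "\<psi> \<in> hermitian_characters" "\<forall>x. cmod (\<psi> x) \<le> q x" using below[OF q(1,2)] by blast
      \<comment> \<open>The modulus of \<open>\<psi>\<close> lies below \<open>q\<close>, hence
        below that of \<open>\<phi>\<close>; equality squeezes \<open>q\<close> between two copies
        of \<open>p\<close>.\<close>
      have "\<psi> = \<phi>"
        by (rule dominated_by_character_imp_eq[OF \<psi>(1) \<phi>(1)]) (use \<psi>(2) q(3) p in \<open>blast intro: order_trans\<close>)
      with \<psi>(2) q(3) show ?thesis unfolding p by (intro ext antisym) auto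
    qed
    then show "minimal_continuous_Cstar_seminorm t p"
      using \<phi> nonzero Cstar_seminorm_cmod_character
      unfolding minimal_continuous_Cstar_seminorm_def cont p by blast
  qed
qed

theorem theorem2p4:
  fixes \<Gamma> :: "('a::involutive_algebra \<Rightarrow> complex) set"
  assumes "\<Gamma> \<subseteq> hermitian_characters" and "\<Gamma> \<noteq> {}"
  shows
    "(\<exists>t. t \<in> compatible_LCstar_topologies \<Gamma>) \<and>
     (\<forall>t \<in> compatible_LCstar_topologies \<Gamma>.
        \<exists>B. (\<forall>K\<in>B. compactin hermitian_character_space K \<and> K \<subseteq> \<Gamma>) \<and> \<Gamma> \<subseteq> \<Union>B \<and>
            t = uniform_convergence_topology B) \<and>
     weakest_topology_in (compatible_LCstar_topologies \<Gamma>)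
       (uniform_convergence_topology {K. finite K \<and> K \<subseteq> \<Gamma>}) \<and>
     strongest_topology_in (compatible_LCstar_topologies \<Gamma>)
       (uniform_convergence_topology {K. compactin hermitian_character_space K \<and> K \<subseteq> \<Gamma>}) \<and>
     (\<forall>t \<in> compatible_LCstar_topologies \<Gamma>.
        Hausdorff_space t \<longleftrightarrow> (\<forall>x y. x \<noteq> y \<longrightarrow> (\<exists>\<phi>\<in>\<Gamma>. \<phi> x \<noteq> \<phi> y))) \<and>
     (\<forall>t \<in> compatible_LCstar_topologies \<Gamma>. \<forall>t' \<in> compatible_LCstar_topologies \<Gamma>.
        \<forall>p. minimal_continuous_Cstar_seminorm t p \<longleftrightarrow> minimal_continuous_Cstar_seminorm t' p)"
proof (intro conjI ballI allI)
  show weakest: "weakest_topology_in (compatible_LCstar_topologies \<Gamma>)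
      (uniform_convergence_topology {K. finite K \<and> K \<subseteq> \<Gamma>})"
    using assms(1) by (rule weakest_compatible_LCstar_topology)
  then show "\<exists>t. t \<in> compatible_LCstar_topologies \<Gamma>" by (auto simp: weakest_topology_in_def)
  show "\<exists>B. (\<forall>K\<in>B. compactin hermitian_character_space K \<and> K \<subseteq> \<Gamma>) \<and> \<Gamma> \<subseteq> \<Union>B \<and>
      t = uniform_convergence_topology B" if "t \<in> compatible_LCstar_topologies \<Gamma>" for t
    using compatible_LCstar_topology_eq_uniform_convergence[OF that] by metis
qed (use assms in \<open>simp_all add: strongest_compatible_LCstar_topology
      Hausdorff_compatible_LCstar_topology_iff minimal_continuous_Cstar_seminorm_iff\<close>)

end
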